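(* Let $\mathcal{G}=(G,\lambda)$ be a temporal graph with lifetime $\tau$, and let $w$ be the width of a (nice) tree decomposition of the underlying graph $G$ that is available to the algorithm. Then the maximum cardinality of a temporal matching of $\mathcal{G}$ can be computed in time $O^*(2^{w^2}\cdot 8^{w\cdot\tau})$, where $O^*$ suppresses factors polynomial in the input size.
   Context: A temporal graph with lifetime $\tau$ is a pair $\mathcal{G}=(G,\lambda)$ where $G$ is a finite simple undirected graph and $\lambda$ assigns to each edge $e\in E(G)$ a non-empty subset $\lambda(e)\subseteq\{1,\dots,\tau\}$. A temporal matching of $\mathcal{G}$ is a set $M\subseteq E(G)$ such that for all distinct $e,e'\in M$, either $e\cap e'=\emptyset$ or $\lambda(e)\cap\lambda(e')=\emptyset$. *)

theory Defs
  imports Main "HOL-Computational_Algebra.Polynomial"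
begin

section \<open>Temporal graphs and temporal matchings\<close>

definition simple_graph :: "'v set \<Rightarrow> 'v set set \<Rightarrow> bool" where
  "simple_graph V E \<longleftrightarrow> finite V \<and> (\<forall>e\<in>E. e \<subseteq> V \<and> card e = 2)"

definition temporal_graph ::
    "'v set \<Rightarrow> 'v set set \<Rightarrow> ('v set \<Rightarrow> nat set) \<Rightarrow> nat \<Rightarrow> bool" where
  "temporal_graph V E lam tau \<longleftrightarrow>
     simple_graph V E \<and> (\<forall>e\<in>E. lam e \<noteq> {} \<and> lam e \<subseteq> {1..tau})"

definition temporal_matching ::
    "'v set set \<Rightarrow> ('v set \<Rightarrow> nat set) \<Rightarrow> 'v set set \<Rightarrow> bool" where
  "temporal_matching E lam M \<longleftrightarrow>
     M \<subseteq> E \<and> (\<forall>e\<in>M. \<forall>e'\<in>M. e \<noteq> e' \<longrightarrow> e \<inter> e' = {} \<or> lam e \<inter> lam e' = {})"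

definition max_temporal_matching :: "'v set set \<Rightarrow> ('v set \<Rightarrow> nat set) \<Rightarrow> nat" where
  "max_temporal_matching E lam = Max (card ` {M. temporal_matching E lam M})"

section \<open>Tree decompositions\<close>

text \<open>The subgraph induced by the node set \<open>S\<close> is connected (vacuously so for empty \<open>S\<close>).\<close>

definition connected_on :: "'i set \<Rightarrow> 'i set set \<Rightarrow> bool" where
  "connected_on S F \<longleftrightarrow>
     (\<forall>x\<in>S. \<forall>y\<in>S. (x, y) \<in> {(a, b). a \<in> S \<and> b \<in> S \<and> {a, b} \<in> F}\<^sup>*)"

definition is_cycle :: "'i set set \<Rightarrow> 'i list \<Rightarrow> bool" where
  "is_cycle F c \<longleftrightarrow> 3 \<le> length c \<and> distinct c \<and>
     (\<forall>k<length c. {c ! k, c ! (Suc k mod length c)} \<in> F)"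

definition is_tree :: "'i set \<Rightarrow> 'i set set \<Rightarrow> bool" where
  "is_tree I F \<longleftrightarrow>
     simple_graph I F \<and> I \<noteq> {} \<and> connected_on I F \<and> (\<nexists>c. is_cycle F c)"

definition tree_decomposition ::
    "'v set \<Rightarrow> 'v set set \<Rightarrow> 'i set \<Rightarrow> 'i set set \<Rightarrow> ('i \<Rightarrow> 'v set) \<Rightarrow> bool" where
  "tree_decomposition V E I F B \<longleftrightarrow>
     is_tree I F \<and>
     (\<Union>i\<in>I. B i) = V \<and>
     (\<forall>e\<in>E. \<exists>i\<in>I. e \<subseteq> B i) \<and>
     (\<forall>v\<in>V. connected_on {i \<in> I. v \<in> B i} F)"

text \<open>Natural-number subtraction is harmless here: it only gives width 0 instead of \<open>-1\<close> to a
  decomposition of the empty graph.\<close>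

definition width :: "'i set \<Rightarrow> ('i \<Rightarrow> 'v set) \<Rightarrow> nat" where
  "width I B = Max ((\<lambda>i. card (B i)) ` I) - 1"

text \<open>Decompositions are handed over as rooted trees of bags, of arbitrary branching. The nodes of
  the underlying graph-theoretic tree are the positions, that is the lists of child indices leading
  from the root to a node.\<close>

datatype 'a rtree = RNode (label: 'a) (children: "'a rtree list")

fun subtree_at :: "'a rtree \<Rightarrow> nat list \<Rightarrow> 'a rtree option" where
  "subtree_at t [] = Some t"
| "subtree_at (RNode a ts) (i # p) = (if i < length ts then subtree_at (ts ! i) p else None)"

definition positions :: "'a rtree \<Rightarrow> nat list set" where
  "positions t = {p. subtree_at t p \<noteq> None}"

definition position_edges :: "'a rtree \<Rightarrow> nat list set set" where
  "position_edges t = {{p, p @ [i]} | p i. p @ [i] \<in> positions t}"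

definition label_at :: "'a rtree \<Rightarrow> nat list \<Rightarrow> 'a" where
  "label_at t p = label (the (subtree_at t p))"

definition rooted_tree_decomposition :: "'v set \<Rightarrow> 'v set set \<Rightarrow> 'v set rtree \<Rightarrow> bool" where
  "rooted_tree_decomposition V E D \<longleftrightarrow>
     tree_decomposition V E (positions D) (position_edges D) (label_at D)"

definition rtree_width :: "'v set rtree \<Rightarrow> nat" where
  "rtree_width D = width (positions D) (label_at D)"

lemma positions_Node:
  "positions (RNode a ts) = insert [] (\<Union>i<length ts. (#) i ` positions (ts ! i))"
proof (rule set_eqI)
  fix p show "p \<in> positions (RNode a ts) \<longleftrightarrow>
      p \<in> insert [] (\<Union>i<length ts. (#) i ` positions (ts ! i))"
    by (cases p) (auto simp: positions_def split: if_splits)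
qed

lemma finite_positions: "finite (positions t)"
proof (induction t)
  case (RNode a ts)
  then show ?case by (auto simp: positions_Node)
qed

lemma positions_prefix: "p @ q \<in> positions t \<Longrightarrow> p \<in> positions t"
proof (induction p arbitrary: t)
  case Nil
  then show ?case by (simp add: positions_def)
next
  case (Cons i p)
  then show ?case by (cases t) (auto simp: positions_def split: if_splits)
qed

text \<open>The positions of a rooted tree always form a tree, so that clause of
  \<open>rooted_tree_decomposition\<close> excludes nothing.\<close>

lemma is_tree_positions: "is_tree (positions t) (position_edges t)"
proof -
  let ?I = "positions t" and ?F = "position_edges t"
  let ?R = "{(a, b). a \<in> ?I \<and> b \<in> ?I \<and> {a, b} \<in> ?F}"
  have sg: "simple_graph ?I ?F"
    using positions_prefix
    by (fastforce simp: simple_graph_def finite_positions position_edges_def card_2_iff)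
  have root: "(p, []) \<in> ?R\<^sup>* \<and> ([], p) \<in> ?R\<^sup>*" if "p \<in> ?I" for p
    using that
  proof (induction p rule: rev_induct)
    case Nil
    then show ?case by simp
  next
    case (snoc i p)
    then have p: "p \<in> ?I" using positions_prefix by blast
    have "{p, p @ [i]} \<in> ?F" using snoc.prems by (auto simp: position_edges_def)
    then have "(p, p @ [i]) \<in> ?R" "(p @ [i], p) \<in> ?R"
      using p snoc.prems by (auto simp: insert_commute)
    with snoc.IH[OF p] show ?case
      by (meson converse_rtrancl_into_rtrancl rtrancl.rtrancl_into_rtrancl)
  qed
  have conn: "connected_on ?I ?F"
    unfolding connected_on_def using root by (meson rtrancl_trans)
  have ne: "?I \<noteq> {}" by (auto simp: positions_def intro!: exI[of _ "[]"])
  have up: "q = butlast p" if "{p, q} \<in> ?F" "length q \<le> length p" for p q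
    using that by (auto simp: position_edges_def doubleton_eq_iff)
  have acyc: "\<not> is_cycle ?F c" for c
  proof
    assume c: "is_cycle ?F c"
    let ?n = "length c"
    have n: "3 \<le> ?n" and d: "distinct c"
      and e: "\<And>k. k < ?n \<Longrightarrow> {c ! k, c ! (Suc k mod ?n)} \<in> ?F"
      using c by (auto simp: is_cycle_def)
    have "Max (length ` set c) \<in> length ` set c" using n by (intro Max_in) auto
    then obtain k where k: "k < ?n" "length (c ! k) = Max (length ` set c)"
      by (auto simp: in_set_conv_nth)
    have mx: "length (c ! j) \<le> length (c ! k)" if "j < ?n" for j
      using that k by simp
    define s where "s = Suc k mod ?n"
    define r where "r = (if k = 0 then ?n - 1 else k - 1)"
    have "0 < ?n" using n by linarith
    then have s: "s < ?n" by (simp add: s_def)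
    have r: "r < ?n" and rk: "Suc r mod ?n = k"
      using n k by (auto simp: r_def)
    have "s \<noteq> r" using n k by (auto simp: s_def r_def mod_Suc split: if_splits)
    moreover have "c ! s = butlast (c ! k)"
      using up[OF e[OF k(1), folded s_def] mx[OF s]] .
    moreover have "c ! r = butlast (c ! k)"
      using up[of "c ! k" "c ! r"] e[OF r] mx[OF r] rk by (simp add: insert_commute)
    ultimately show False using d s r by (metis nth_eq_iff_index_eq)
  qed
  show ?thesis using sg ne conn acyc by (auto simp: is_tree_def)
qed

section \<open>Model of computation\<close>

text \<open>Programs are systems of first-order, call-by-value recursive functions over binary trees
  (pure Lisp), with unit cost for each evaluation step. There are no primitive numbers, and the only
  test distinguishes an atom from a cell, so no step hides non-constant work: cells are shared
  pointers, and the length of an environment is bounded by a constant of the program. Running times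
  of such programs and of random access machines agree up to factors logarithmic in the running
  time.\<close>

datatype data = Atom | Cell data data

fun hd_data :: "data \<Rightarrow> data" where
  "hd_data Atom = Atom"
| "hd_data (Cell a b) = a"

fun tl_data :: "data \<Rightarrow> data" where
  "tl_data Atom = Atom"
| "tl_data (Cell a b) = b"

text \<open>Variables are positions in the environment; \<open>Bind e b\<close> evaluates \<open>b\<close> with the value of
  \<open>e\<close> pushed onto it. \<open>Call f as\<close> evaluates the body \<open>P ! f\<close> in the environment consisting of
  the argument values only.\<close>

datatype exp =
    Var nat
  | MkAtom
  | MkCell exp exp
  | Hd exp
  | Tl exp
  | Cond exp exp exp
  | Bind exp exp
  | Call nat "exp list"

type_synonym program = "exp list"

inductive eval :: "program \<Rightarrow> data list \<Rightarrow> exp \<Rightarrow> data \<Rightarrow> nat \<Rightarrow> bool"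
  and evals :: "program \<Rightarrow> data list \<Rightarrow> exp list \<Rightarrow> data list \<Rightarrow> nat \<Rightarrow> bool"
  for P :: program where
  eval_Var: "k < length env \<Longrightarrow> eval P env (Var k) (env ! k) 1"
| eval_MkAtom: "eval P env MkAtom Atom 1"
| eval_MkCell: "eval P env e1 v1 t1 \<Longrightarrow> eval P env e2 v2 t2 \<Longrightarrow>
    eval P env (MkCell e1 e2) (Cell v1 v2) (t1 + t2 + 1)"
| eval_Hd: "eval P env e v t \<Longrightarrow> eval P env (Hd e) (hd_data v) (t + 1)"
| eval_Tl: "eval P env e v t \<Longrightarrow> eval P env (Tl e) (tl_data v) (t + 1)"
| eval_Cond_Cell: "eval P env e (Cell a b) t \<Longrightarrow> eval P env e1 v t1 \<Longrightarrow>
    eval P env (Cond e e1 e2) v (t + t1 + 1)"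
| eval_Cond_Atom: "eval P env e Atom t \<Longrightarrow> eval P env e2 v t2 \<Longrightarrow>
    eval P env (Cond e e1 e2) v (t + t2 + 1)"
| eval_Bind: "eval P env e u t1 \<Longrightarrow> eval P (u # env) b v t2 \<Longrightarrow>
    eval P env (Bind e b) v (t1 + t2 + 1)"
| eval_Call: "evals P env es vs t1 \<Longrightarrow> f < length P \<Longrightarrow> eval P vs (P ! f) v t2 \<Longrightarrow>
    eval P env (Call f es) v (t1 + t2 + 1)"
| evals_Nil: "evals P env [] [] 0"
| evals_Cons: "eval P env e v t1 \<Longrightarrow> evals P env es vs t2 \<Longrightarrow>
    evals P env (e # es) (v # vs) (t1 + t2)"

inductive_cases eval_elims:
  "eval P env (Var k) v t" "eval P env MkAtom v t" "eval P env (MkCell e1 e2) v t"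
  "eval P env (Hd e) v t" "eval P env (Tl e) v t" "eval P env (Cond e e1 e2) v t"
  "eval P env (Bind e b) v t" "eval P env (Call f es) v t"

inductive_cases evals_elims: "evals P env [] vs t" "evals P env (e # es) vs t"

lemma eval_deterministic:
  "eval P env e v t \<Longrightarrow> eval P env e v' t' \<Longrightarrow> v' = v \<and> t' = t"
  "evals P env es vs s \<Longrightarrow> evals P env es vs' s' \<Longrightarrow> vs' = vs \<and> s' = s"
  apply (induction arbitrary: v' t' and vs' s' rule: eval_evals.inducts)
            apply (erule eval_elims, metis Suc_eq_plus1 add_0)
           apply (erule eval_elims, metis Suc_eq_plus1 add_0)
          apply (erule eval_elims, metis Suc_eq_plus1)
         apply (erule eval_elims, metis Suc_eq_plus1)
        apply (erule eval_elims, metis Suc_eq_plus1)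
       apply (erule eval_elims; metis Suc_eq_plus1 data.distinct(1))
      apply (erule eval_elims; metis Suc_eq_plus1 data.distinct(1))
     apply (erule eval_elims, metis Suc_eq_plus1)
    apply (erule eval_elims, metis Suc_eq_plus1)
   apply (erule evals_elims, metis)
  apply (erule evals_elims, metis)
  done

definition runs :: "program \<Rightarrow> data \<Rightarrow> data \<Rightarrow> nat \<Rightarrow> bool" where
  "runs P x v t \<longleftrightarrow> P \<noteq> [] \<and> eval P [x] (P ! 0) v t"

section \<open>Encoding of the input\<close>

fun enc_nat :: "nat \<Rightarrow> data" where
  "enc_nat n =
     (if n = 0 then Atom
      else Cell (if odd n then Cell Atom Atom else Atom) (enc_nat (n div 2)))"

declare enc_nat.simps [simp del]

definition enc_list :: "data list \<Rightarrow> data" where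
  "enc_list ds = foldr Cell ds Atom"

definition enc_nats :: "nat list \<Rightarrow> data" where
  "enc_nats ns = enc_list (map enc_nat ns)"

text \<open>A time-labelled edge is listed as its two end points, in either order, together with the list
  of its time labels.\<close>

type_synonym tedge = "(nat \<times> nat) \<times> nat list"

fun ends :: "tedge \<Rightarrow> nat set" where
  "ends ((u, v), ls) = {u, v}"

fun enc_tedge :: "tedge \<Rightarrow> data" where
  "enc_tedge ((u, v), ls) = Cell (Cell (enc_nat u) (enc_nat v)) (enc_nats ls)"

primrec enc_rtree :: "nat list rtree \<Rightarrow> data" where
  "enc_rtree (RNode b ts) = Cell (enc_nats b) (enc_list (map enc_rtree ts))"

text \<open>\<open>x\<close> is an encoding of the temporal graph with lifetime \<open>tau\<close> and of the decomposition
  \<open>D\<close>. Sets are listed without repetition in an arbitrary order, so an instance has several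
  encodings. The input length is \<open>size x\<close>, the number of cells of \<open>x\<close>; as numbers are written in
  binary, least significant bit first, it is the usual bit length up to a constant factor.\<close>

definition encodes :: "nat set \<Rightarrow> nat set set \<Rightarrow> (nat set \<Rightarrow> nat set) \<Rightarrow> nat \<Rightarrow>
    nat set rtree \<Rightarrow> data \<Rightarrow> bool" where
  "encodes V E lam tau D x \<longleftrightarrow> (\<exists>vs es d.
     distinct vs \<and> set vs = V \<and>
     distinct (map ends es) \<and> ends ` set es = E \<and>
     (\<forall>e\<in>set es. distinct (snd e) \<and> set (snd e) = lam (ends e)) \<and>
     (\<forall>b\<in>set_rtree d. distinct b) \<and> map_rtree set d = D \<and>
     x = enc_list [enc_nats vs, enc_list (map enc_tedge es), enc_nat tau, enc_rtree d])"

end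

theory Submission imports Defs begin

text \<open>A temporal matching is a packing of the sets \<open>e \<times> lam e\<close> of vertex-time pairs. The program
  does dynamic programming over the decomposition. For a bag \<open>b\<close>, a decision trie stores for every
  set \<open>U\<close> of pairs over \<open>b\<close> the size of a largest packing of edges seen so far that uses only
  pairs in \<open>U\<close> over \<open>b\<close> and is unrestricted elsewhere. Tables for two parts that only meet in \<open>b\<close> are
  combined by a max-plus convolution over disjoint sets; single edges are tables as well, and an edge
  seen twice does no harm because it conflicts with itself. Hiding the vertices of a child outside the
  bag of its parent means declaring their pairs available, hence passing to the right subtrie.

  A convolution makes three recursive calls at a pair visible in both tables and two at a pair
  visible in one. A child whose bag is contained in \<open>b\<close> is not given a table of its own, so
  two combined bags share at most \<open>w\<close> vertices, and \<open>3 ^ (w k) * 2 ^ k \<le> 8 ^ (w k)\<close> for \<open>w \<ge> 1\<close>,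
  where \<open>k \<le> tau\<close> is the number of labels that occur. Restricting to these labels also covers
  \<open>w = 0\<close>, where there are no edges and so no labels.\<close>

section \<open>Evaluating programs by rewriting\<close>

text \<open>The obstacle is the base 8. Joining two tables that both see \<open>w + 1\<close>
  vertices may cost \<open>3 ^ ((w + 1) * k)\<close>, which for \<open>w = 1\<close> is
  \<open>9 ^ k\<close> against the allowed \<open>8 ^ k\<close>. So in each join one side must see
  at most \<open>w\<close> vertices. A child whose bag lies inside \<open>b\<close> hands its own
  children on to the table of \<open>b\<close>; nothing is lost, as its edges were already seen at
  \<open>b\<close>. A single edge raises the same difficulty, since its pairs cover two vertices;
  there the left subtables of the edge table are \<open>Zero\<close>, so two of the three calls
  return at once.

  Values are stored in unary below all decisions. Adding two of them is concatenation, and binary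
  arithmetic occurs only in the final conversion. The root is treated as the child of an empty bag:
  the resulting table has no decisions left and ends in the optimum.

  The join gives a pair that only one side sees entirely to that side. This is optimal because every
  table is monotone in \<open>U\<close>, a fact that follows from the meaning of the table and is
  not part of its format.\<close>

text \<open>Value, time and definedness of an expression are computed by structural recursion that stops at
  calls, so the simplifier can evaluate one function body at a time. \<open>fun_val\<close> and \<open>fun_time\<close> are
  meaningful only under \<open>fun_ok\<close>.\<close>

definition fun_ok :: "program \<Rightarrow> nat \<Rightarrow> data list \<Rightarrow> bool" where
  "fun_ok P f vs \<longleftrightarrow> f < length P \<and> (\<exists>v t. eval P vs (P ! f) v t)"

definition fun_val :: "program \<Rightarrow> nat \<Rightarrow> data list \<Rightarrow> data" where
  "fun_val P f vs = (THE v. \<exists>t. eval P vs (P ! f) v t)"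

definition fun_time :: "program \<Rightarrow> nat \<Rightarrow> data list \<Rightarrow> nat" where
  "fun_time P f vs = (THE t. \<exists>v. eval P vs (P ! f) v t)"

primrec ex_val :: "program \<Rightarrow> exp \<Rightarrow> data list \<Rightarrow> data" where
  "ex_val P (Var k) env = env ! k"
| "ex_val P MkAtom env = Atom"
| "ex_val P (MkCell a b) env = Cell (ex_val P a env) (ex_val P b env)"
| "ex_val P (Hd e) env = hd_data (ex_val P e env)"
| "ex_val P (Tl e) env = tl_data (ex_val P e env)"
| "ex_val P (Cond e a b) env =
     (if ex_val P e env = Atom then ex_val P b env else ex_val P a env)"
| "ex_val P (Bind e b) env = ex_val P b (ex_val P e env # env)"
| "ex_val P (Call f es) env = fun_val P f (map (\<lambda>e. ex_val P e env) es)"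

primrec ex_time :: "program \<Rightarrow> exp \<Rightarrow> data list \<Rightarrow> nat" where
  "ex_time P (Var k) env = 1"
| "ex_time P MkAtom env = 1"
| "ex_time P (MkCell a b) env = ex_time P a env + ex_time P b env + 1"
| "ex_time P (Hd e) env = ex_time P e env + 1"
| "ex_time P (Tl e) env = ex_time P e env + 1"
| "ex_time P (Cond e a b) env = ex_time P e env +
     (if ex_val P e env = Atom then ex_time P b env else ex_time P a env) + 1"
| "ex_time P (Bind e b) env = ex_time P e env + ex_time P b (ex_val P e env # env) + 1"
| "ex_time P (Call f es) env = sum_list (map (\<lambda>e. ex_time P e env) es) +
     fun_time P f (map (\<lambda>e. ex_val P e env) es) + 1"

primrec ex_ok :: "program \<Rightarrow> exp \<Rightarrow> data list \<Rightarrow> bool" where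
  "ex_ok P (Var k) env = (k < length env)"
| "ex_ok P MkAtom env = True"
| "ex_ok P (MkCell a b) env = (ex_ok P a env \<and> ex_ok P b env)"
| "ex_ok P (Hd e) env = ex_ok P e env"
| "ex_ok P (Tl e) env = ex_ok P e env"
| "ex_ok P (Cond e a b) env = (ex_ok P e env \<and>
     (if ex_val P e env = Atom then ex_ok P b env else ex_ok P a env))"
| "ex_ok P (Bind e b) env = (ex_ok P e env \<and> ex_ok P b (ex_val P e env # env))"
| "ex_ok P (Call f es) env = (list_all id (map (\<lambda>e. ex_ok P e env) es) \<and>
     fun_ok P f (map (\<lambda>e. ex_val P e env) es))"

lemma fun_ok_eval:
  assumes "eval P vs (P ! f) v t"
  shows "fun_val P f vs = v" "fun_time P f vs = t"
  using assms eval_deterministic(1)[OF assms] unfolding fun_val_def fun_time_def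
  by (blast intro: the_equality)+

lemma ex_ok_eval: "ex_ok P e env \<Longrightarrow> eval P env e (ex_val P e env) (ex_time P e env)"
proof (induction e arbitrary: env)
  case (Call f es)
  then have "\<forall>e\<in>set es. eval P env e (ex_val P e env) (ex_time P e env)"
    by (auto simp: list_all_iff)
  then have "evals P env es (map (\<lambda>e. ex_val P e env) es) (sum_list (map (\<lambda>e. ex_time P e env) es))"
    by (induction es) (auto intro: eval_evals.intros)
  moreover obtain v t where "eval P (map (\<lambda>e. ex_val P e env) es) (P ! f) v t" "f < length P"
    using Call.prems by (auto simp: fun_ok_def)
  ultimately show ?case
    using eval_Call fun_ok_eval by fastforce
next
  case (Cond e a b)
  show ?case
  proof (cases "ex_val P e env")
    case Atom
    then show ?thesis using Cond by (simp add: eval_Cond_Atom[simplified])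
        (metis Cond.IH(1,3) Suc_eq_plus1 eval_Cond_Atom)
  next
    case (Cell x y)
    then show ?thesis using Cond by simp
        (metis Cond.IH(1,2) Suc_eq_plus1 eval_Cond_Cell)
  qed
qed (auto intro: eval_evals.intros[simplified])

definition computes :: "program \<Rightarrow> nat \<Rightarrow> data list \<Rightarrow> data \<Rightarrow> nat \<Rightarrow> bool" where
  "computes P f vs v B \<longleftrightarrow> fun_ok P f vs \<and> fun_val P f vs = v \<and> fun_time P f vs \<le> B"

text \<open>This treats one function body at a time: calls inside it remain opaque
  \<open>fun_ok\<close>, \<open>fun_val\<close> and \<open>fun_time\<close> terms, which
  \<open>computesD\<close> of the callee then rewrites or bounds.\<close>

lemma computesI:
  assumes "f < length P" "ex_ok P (P ! f) vs" "ex_val P (P ! f) vs = v" "ex_time P (P ! f) vs \<le> B"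
  shows "computes P f vs v B"
  using assms ex_ok_eval[OF assms(2)] fun_ok_eval[OF ex_ok_eval[OF assms(2)]]
  by (auto simp: computes_def fun_ok_def)

lemma computesD:
  assumes "computes P f vs v B"
  shows "fun_ok P f vs" "fun_val P f vs = v" "fun_time P f vs \<le> B"
  using assms by (auto simp: computes_def)

lemma computes_mono: "computes P f vs v B \<Longrightarrow> B \<le> B' \<Longrightarrow> computes P f vs v B'"
  by (auto simp: computes_def)

section \<open>The program\<close>

abbreviation "mk_true \<equiv> MkCell MkAtom MkAtom"
abbreviation "mk_branch a b \<equiv> MkCell (MkCell mk_true a) b"
text \<open>\<open>Bind\<close> evaluates \<open>a\<close> once and stores the result in both
  places, so an ignored variable costs a single recursive call.\<close>

abbreviation "mk_skip a \<equiv> Bind a (MkCell (MkCell MkAtom (Var 0)) (Var 0))"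
abbreviation "high e \<equiv> Tl e"
abbreviation "low e \<equiv> Tl (Hd e)"
abbreviation "tag e \<equiv> Hd (Hd e)"

abbreviation (input) "EQ \<equiv> Suc 0"
abbreviation (input) "MEM \<equiv> 2 :: nat"
abbreviation (input) "SUB \<equiv> 3 :: nat"
abbreviation (input) "UNION \<equiv> 4 :: nat"
abbreviation (input) "LABELS \<equiv> 5 :: nat"
abbreviation (input) "PAIRS \<equiv> 6 :: nat"
abbreviation (input) "PRODUCT \<equiv> 7 :: nat"
abbreviation (input) "PMAX \<equiv> 8 :: nat"
abbreviation (input) "CONV \<equiv> 9 :: nat"
abbreviation (input) "RES \<equiv> 10 :: nat"
abbreviation (input) "EDGE \<equiv> 11 :: nat"
abbreviation (input) "ADD \<equiv> 12 :: nat"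
abbreviation (input) "ABSORB \<equiv> 13 :: nat"
abbreviation (input) "INC \<equiv> 14 :: nat"
abbreviation (input) "BIN \<equiv> 15 :: nat"

text \<open>The two leading \<open>MkAtom\<close> arguments of \<open>ABSORB\<close> are the empty
  bag and the table \<open>Zero\<close>; the decomposition is passed as a one-element list of
  children of that empty bag.\<close>

definition "main_body =
  Bind (Call PRODUCT [Hd (Var 0), Call LABELS [Hd (Tl (Var 0)), MkAtom]])
    (Call BIN [Call ABSORB [MkAtom, MkAtom, MkCell (Hd (Tl (Tl (Tl (Var 1))))) MkAtom, Var 0,
       Hd (Tl (Var 1))]])"

definition "eq_body =
  Cond (Var 0)
    (Cond (Var 1)
      (Cond (Call EQ [Hd (Var 0), Hd (Var 1)]) (Call EQ [Tl (Var 0), Tl (Var 1)]) MkAtom)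
      MkAtom)
    (Cond (Var 1) MkAtom mk_true)"

definition "mem_body =
  Cond (Var 1)
    (Cond (Call EQ [Var 0, Hd (Var 1)]) mk_true (Call MEM [Var 0, Tl (Var 1)]))
    MkAtom"

definition "sub_body =
  Cond (Var 0)
    (Cond (Call MEM [Hd (Var 0), Var 1]) (Call SUB [Tl (Var 0), Var 1]) MkAtom)
    mk_true"

definition "union_body =
  Cond (Var 0)
    (Call UNION [Tl (Var 0),
      Cond (Call MEM [Hd (Var 0), Var 1]) (Var 1) (MkCell (Hd (Var 0)) (Var 1))])
    (Var 1)"

definition "labels_body =
  Cond (Var 0) (Call LABELS [Tl (Var 0), Call UNION [Tl (Hd (Var 0)), Var 1]]) (Var 1)"

definition "pairs_body =
  Cond (Var 1)
    (MkCell (MkCell (Var 0) (Hd (Var 1))) (Call PAIRS [Var 0, Tl (Var 1), Var 2]))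
    (Var 2)"

definition "product_body =
  Cond (Var 0)
    (Call PAIRS [Hd (Var 0), Var 1, Call PRODUCT [Tl (Var 0), Var 1]])
    MkAtom"

text \<open>Both tables fit the same variable list, so if neither is \<open>Zero\<close> they are
  both inner nodes or both \<open>Plus1\<close>; testing \<open>Hd\<close> of the first one decides
  which.\<close>

definition "max_body =
  (let br = mk_branch (Call PMAX [low (Var 0), low (Var 1)]) (Call PMAX [high (Var 0), high (Var 1)])
   in Cond (Var 0)
        (Cond (Var 1)
          (Cond (Hd (Var 0))
            (Cond (tag (Var 0)) br
              (Cond (tag (Var 1)) br (mk_skip (Call PMAX [high (Var 0), high (Var 1)]))))
            (MkCell MkAtom (Call PMAX [Tl (Var 0), Tl (Var 1)])))
          (Var 0))
        (Var 1))"

definition "conv_body =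
  (let br = mk_branch (Call CONV [low (Var 0), low (Var 1)]) (Call CONV [high (Var 0), high (Var 1)])
   in Cond (Var 0)
        (Cond (Var 1)
          (Cond (Hd (Var 0))
            (Cond (tag (Var 0))
              (Cond (tag (Var 1))
                (mk_branch (Call CONV [low (Var 0), low (Var 1)])
                  (Call PMAX [Call CONV [low (Var 0), high (Var 1)],
                             Call CONV [high (Var 0), low (Var 1)]]))
                br)
              (Cond (tag (Var 1)) br (mk_skip (Call CONV [high (Var 0), high (Var 1)]))))
            (MkCell MkAtom (Call CONV [Tl (Var 0), Var 1])))
          (Var 0))
        (Var 1))"

text \<open>The expression \<open>sk\<close> serves two cases: \<open>high\<close> is the only
  subtable of a \<open>Skip\<close>, and it is also the subtable kept when a \<open>Branch\<close>
  at a hidden variable is removed.\<close>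

definition "res_body =
  (let sk = mk_skip (Call RES [Var 0, Tl (Var 1), high (Var 2)])
   in Cond (Hd (Var 2))
        (Cond (tag (Var 2))
          (Cond (Call MEM [Hd (Hd (Var 1)), Var 0])
            (mk_branch (Call RES [Var 0, Tl (Var 1), low (Var 2)])
              (Call RES [Var 0, Tl (Var 1), high (Var 2)]))
            sk)
          sk)
        (Var 2))"

text \<open>At the end of the variable list \<open>mk_true\<close> is the encoding of
  \<open>Plus1 Zero\<close>, and the \<open>MkAtom\<close> inside \<open>mk_branch\<close> is that
  of \<open>Zero\<close>.\<close>

definition "edge_body =
  Cond (Var 1)
    (Bind (Call EDGE [Var 0, Tl (Var 1)])
      (Cond
        (Cond (Call EQ [Hd (Hd (Var 2)), Hd (Hd (Var 1))]) (Call MEM [Tl (Hd (Var 2)), Tl (Var 1)])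
          (Cond (Call EQ [Hd (Hd (Var 2)), Tl (Hd (Var 1))]) (Call MEM [Tl (Hd (Var 2)), Tl (Var 1)])
            MkAtom))
        (mk_branch MkAtom (Var 0))
        (mk_skip (Var 0))))
    mk_true"

definition "add_body =
  Cond (Var 1)
    (Call ADD [Var 0, Tl (Var 1), Var 2,
      Cond (Call MEM [Hd (Hd (Hd (Var 1))), Var 0])
        (Cond (Call MEM [Tl (Hd (Hd (Var 1))), Var 0])
          (Call CONV [Var 3, Call EDGE [Hd (Var 1), Var 2]])
          (Var 3))
        (Var 3)])
    (Var 3)"

definition "absorb_body =
  Cond (Var 2)
    (Call ABSORB [Var 0,
      Cond (Call SUB [Hd (Hd (Var 2)), Var 0])
        (Call ABSORB [Var 0, Var 1, Tl (Hd (Var 2)), Var 3, Var 4])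
        (Call CONV [Var 1, Call RES [Var 0, Var 3,
          Call ABSORB [Hd (Hd (Var 2)),
            Call ADD [Hd (Hd (Var 2)), Var 4, Var 3, MkAtom],
            Tl (Hd (Var 2)), Var 3, Var 4]]]),
      Tl (Var 2), Var 3, Var 4])
    (Var 1)"

definition "inc_body =
  Cond (Var 0)
    (Cond (Hd (Var 0))
      (MkCell MkAtom (Call INC [Tl (Var 0)]))
      (MkCell mk_true (Tl (Var 0))))
    (MkCell mk_true MkAtom)"

definition "bin_body =
  Cond (Var 0)
    (Cond (Hd (Var 0))
      (Call BIN [Tl (Var 0)])
      (Call INC [Call BIN [Tl (Var 0)]]))
    MkAtom"

definition prog :: program where
  "prog = [main_body, eq_body, mem_body, sub_body, union_body, labels_body, pairs_body,
     product_body, max_body, conv_body, res_body, edge_body, add_body, absorb_body, inc_body,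
     bin_body]"

lemma length_prog [simp]: "length prog = 16"
  by (simp add: prog_def)

lemma prog_nth [simp]:
  "prog ! 0 = main_body" "prog ! EQ = eq_body" "prog ! MEM = mem_body" "prog ! SUB = sub_body"
  "prog ! UNION = union_body" "prog ! LABELS = labels_body" "prog ! PAIRS = pairs_body"
  "prog ! PRODUCT = product_body" "prog ! PMAX = max_body" "prog ! CONV = conv_body"
  "prog ! RES = res_body" "prog ! EDGE = edge_body" "prog ! ADD = add_body"
  "prog ! ABSORB = absorb_body" "prog ! INC = inc_body" "prog ! BIN = bin_body"
  by (simp_all add: prog_def)

section \<open>Numbers and lists\<close>

definition enc_bool :: "bool \<Rightarrow> data" where
  "enc_bool b = (if b then Cell Atom Atom else Atom)"

lemma enc_bool_simps [simp]:
  "enc_bool b = Atom \<longleftrightarrow> \<not> b" "enc_bool True = Cell Atom Atom" "enc_bool False = Atom"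
  by (auto simp: enc_bool_def)

lemma enc_list_simps [simp]: "enc_list [] = Atom" "enc_list (x # xs) = Cell x (enc_list xs)"
  by (auto simp: enc_list_def)

text \<open>The comparison descends in both arguments together and stops at an atom of either, so
  the size of one argument suffices as a bound. Searching a list therefore costs no more for a large
  key.\<close>

lemma eq_computes: "computes prog EQ [a, b] (enc_bool (a = b)) (100 * size b + 40)"
proof (induction a arbitrary: b)
  case Atom
  show ?case by (rule computesI) (cases b; simp add: eq_body_def)+
next
  case (Cell x y)
  show ?case
  proof (cases b)
    case Atom
    show ?thesis by (rule computesI) (simp_all add: Atom eq_body_def)
  next
    case b: (Cell u v)
    show ?thesis using computesD[OF Cell(1)[of u]] computesD[OF Cell(2)[of v]]
      by (intro computesI) (auto simp add: b eq_body_def)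
  qed
qed

lemmas eq_simps [simp] = computesD(1,2)[OF eq_computes]
lemmas eq_time = computesD(3)[OF eq_computes]

lemma mem_computes:
  "computes prog MEM [x, enc_list l] (enc_bool (x \<in> set l)) (100 * size (enc_list l) + 40)"
proof (induction l)
  case Nil
  show ?case by (rule computesI) (simp_all add: mem_body_def)
next
  case (Cons y l)
  show ?case using computesD[OF Cons] eq_time[of x y]
    by (intro computesI) (auto simp add: mem_body_def)
qed

lemmas mem_simps [simp] = computesD(1,2)[OF mem_computes]
lemmas mem_time = computesD(3)[OF mem_computes]

lemma sub_computes:
  "computes prog SUB [enc_list a, enc_list b] (enc_bool (set a \<subseteq> set b))
     ((length a + 1) * (100 * size (enc_list b) + 60))"
proof (induction a)
  case Nil
  show ?case by (rule computesI) (simp_all add: sub_body_def)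
next
  case (Cons y a)
  show ?case using computesD[OF Cons] mem_time[of y b]
    by (intro computesI) (auto simp add: sub_body_def)
qed



lemma size_enc_list_ge: "x \<in> set l \<Longrightarrow> size x < size (enc_list l)"
  by (induction l) auto

lemma length_le_size_enc_list: "length l \<le> size (enc_list l)"
  by (induction l) auto

lemma size_fold_insert:
  "size (enc_list (fold List.insert l acc)) \<le> size (enc_list l) + size (enc_list acc)"
proof (induction l arbitrary: acc)
  case (Cons x l)
  have "size (enc_list (List.insert x acc)) \<le> Suc (size x + size (enc_list acc))"
    by (auto simp: List.insert_def)
  then show ?case using Cons[of "List.insert x acc"] by simp
qed simp

lemma union_computes:
  "computes prog UNION [enc_list l, enc_list acc] (enc_list (fold List.insert l acc))
     ((length l + 1) * (100 * (size (enc_list l) + size (enc_list acc)) + 100))"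
proof (induction l arbitrary: acc)
  case Nil
  show ?case by (rule computesI) (simp_all add: union_body_def)
next
  case (Cons y l)
  \<comment> \<open>\<open>K\<close> pays for one membership test and remains valid for the rest of
    the list: an element leaving \<open>l\<close> adds at most its own cell and size to
    \<open>acc\<close>.\<close>
  define K where "K = 100 * (size (enc_list (y # l)) + size (enc_list acc)) + 100"
  have K: "(length l + 1) * (100 * (size (enc_list l) + size (enc_list (List.insert y acc))) + 100)
      \<le> (length l + 1) * K"
    unfolding K_def by (rule mult_le_mono2) (auto simp: List.insert_def)
  have "100 * size (enc_list acc) + 100 \<le> K" by (simp add: K_def)
  moreover note computesD[OF Cons[of "List.insert y acc"]] mem_time[of y acc]
  ultimately show ?case unfolding K_def[symmetric] using K
    by (intro computesI; cases "y \<in> set acc") (simp_all add: union_body_def List.insert_def)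
qed

lemma enc_nat_inject [simp]: "enc_nat m = enc_nat n \<longleftrightarrow> m = n"
proof (induction m arbitrary: n rule: less_induct)
  case (less m)
  show ?case
  proof (cases "m = 0 \<or> n = 0")
    case True
    then show ?thesis by (subst (1 2) enc_nat.simps) auto
  next
    case False
    then have "enc_nat (m div 2) = enc_nat (n div 2) \<longleftrightarrow> m div 2 = n div 2" using less by simp
    moreover have "m = n \<longleftrightarrow> m div 2 = n div 2 \<and> (odd m \<longleftrightarrow> odd n)"
      by (metis dvd_div_mult_self odd_two_times_div_two_succ)
    ultimately show ?thesis using False by (subst (1 2) enc_nat.simps) auto
  qed
qed

lemma inj_enc_nat: "inj enc_nat"
  by (simp add: inj_def)



lemma fold_insert_enc_nat:
  "fold List.insert (map enc_nat l) (map enc_nat acc) = map enc_nat (fold List.insert l acc)"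
proof (induction l arbitrary: acc)
  case (Cons x l)
  have "List.insert (enc_nat x) (map enc_nat acc) = map enc_nat (List.insert x acc)"
    by (auto simp: List.insert_def)
  then show ?case using Cons by simp
qed simp

definition occurring_labels :: "tedge list \<Rightarrow> nat list \<Rightarrow> nat list" where
  "occurring_labels es acc = fold (\<lambda>e. List.union (snd e)) es acc"

lemma occurring_labels_simps [simp]:
  "occurring_labels [] acc = acc"
  "occurring_labels (e # es) acc = occurring_labels es (List.union (snd e) acc)"
  by (simp_all add: occurring_labels_def)

lemma occurring_labels_set:
  "set (occurring_labels es acc) = (\<Union>e\<in>set es. set (snd e)) \<union> set acc"
  by (induction es arbitrary: acc) auto

lemma occurring_labels_distinct: "distinct acc \<Longrightarrow> distinct (occurring_labels es acc)"
  by (induction es arbitrary: acc) auto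

lemma labels_computes:
  "computes prog LABELS [enc_list (map enc_tedge es), enc_nats acc] (enc_nats (occurring_labels es acc))
     ((length es + 1) *
        ((size (enc_list (map enc_tedge es)) + 2) *
           (100 * (size (enc_list (map enc_tedge es)) + size (enc_nats acc)) + 100)))"
proof (induction es arbitrary: acc)
  case Nil
  show ?case by (rule computesI) (simp_all add: labels_body_def)
next
  case (Cons e es)
  obtain u v ls where e: "e = ((u, v), ls)" by (metis prod.collapse)
  let ?s = "size (enc_list (map enc_tedge es))"
  let ?S = "size (enc_list (map enc_tedge (e # es)))"
  let ?u = "List.union ls acc"
  let ?K = "(100 * (?S + size (enc_nats acc)) + 100)"
  have s: "?s + size (enc_nats ls) + 2 \<le> ?S" by (simp add: e)
  have len: "length ls \<le> size (enc_nats ls)"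
    using length_le_size_enc_list[of "map enc_nat ls"] by (simp add: enc_nats_def)
  have u: "enc_list (fold List.insert (map enc_nat ls) (map enc_nat acc)) = enc_nats ?u"
    by (simp add: enc_nats_def fold_insert_enc_nat List.union_def)
  have su: "size (enc_nats ?u) \<le> size (enc_nats ls) + size (enc_nats acc)"
    using size_fold_insert[of "map enc_nat ls" "map enc_nat acc"] by (simp add: u enc_nats_def)
  note un = union_computes[of "map enc_nat ls" "map enc_nat acc", unfolded u]
  have "(length es + 1) * ((?s + 2) * (100 * (?s + size (enc_nats ?u)) + 100)) \<le>
      (length es + 1) * ((?S + 2) * ?K)"
    by (intro mult_le_mono) (use s su in auto)
  moreover have "(length ls + 1) * (100 * (size (enc_nats ls) + size (enc_nats acc)) + 100) \<le>
      (?S + 1) * ?K"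
    by (intro mult_le_mono) (use s len in auto)
  moreover have "20 \<le> ?K" by simp
  \<comment> \<open>Of the share of the new edge, \<open>(?S + 1) * ?K\<close> pays for the union
    and the last \<open>?K\<close> for the remaining steps of the body.\<close>
  moreover have "(length (e # es) + 1) * ((?S + 2) * ?K) =
      (length es + 1) * ((?S + 2) * ?K) + (?S + 1) * ?K + ?K"
    by (simp add: algebra_simps)
  ultimately show ?case
    using computesD[OF Cons[of ?u]] computesD[OF un]
    by (intro computesI) (auto simp add: labels_body_def e enc_nats_def List.union_def)
qed

lemma pairs_computes:
  "computes prog PAIRS [v, enc_list ts, enc_list acc] (enc_list (map (Cell v) ts @ acc))
     (60 * length ts + 40)"
proof (induction ts)
  case Nil
  show ?case by (rule computesI) (simp_all add: pairs_body_def)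
next
  case (Cons t ts)
  show ?case using computesD[OF Cons] by (intro computesI) (auto simp add: pairs_body_def)
qed

type_synonym var = "nat \<times> nat"

definition enc_vars :: "var list \<Rightarrow> data" where
  "enc_vars X = enc_list (map (\<lambda>(v, t). Cell (enc_nat v) (enc_nat t)) X)"

lemma enc_vars_simps [simp]:
  "enc_vars [] = Atom"
  "enc_vars ((v, t) # X) = Cell (Cell (enc_nat v) (enc_nat t)) (enc_vars X)"
  by (simp_all add: enc_vars_def)

lemma product_computes:
  "computes prog PRODUCT [enc_nats vs, enc_nats ts] (enc_vars (List.product vs ts))
     ((length vs + 1) * (60 * length ts + 100))"
proof (induction vs)
  case Nil
  show ?case by (rule computesI) (simp_all add: product_body_def enc_nats_def)
next
  case (Cons v vs)
  have "map (Cell (enc_nat v)) (map enc_nat ts) @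
      map (\<lambda>(v, t). Cell (enc_nat v) (enc_nat t)) (List.product vs ts) =
      map (\<lambda>(v, t). Cell (enc_nat v) (enc_nat t)) (List.product (v # vs) ts)"
    by simp
  note p = pairs_computes[of "enc_nat v" "map enc_nat ts"
      "map (\<lambda>(v, t). Cell (enc_nat v) (enc_nat t)) (List.product vs ts)", unfolded this]
  show ?case using computesD[OF Cons] computesD[OF p]
    by (intro computesI) (auto simp add: product_body_def enc_nats_def enc_vars_def)
qed

section \<open>Tables\<close>

text \<open>A table over a list of variables represents a function of a set \<open>U\<close> of variables: at
  the head variable, \<open>Skip\<close> ignores it and \<open>Branch\<close> goes left if it is not in \<open>U\<close> and right
  otherwise. \<open>Zero\<close> may end a path early, whereas \<open>Plus1\<close> only occurs below all variables. The
  subtable of \<open>Skip\<close> is stored twice, so that a program can read the two subtables of any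
  inner node in the same way.\<close>

datatype table = Zero | Plus1 table | Skip table | Branch table table

text \<open>\<open>Hd\<close> of an encoding is a cell exactly for the inner nodes, whose layout is
  tag, left subtable, right subtable; the tag is a cell exactly for \<open>Branch\<close>.\<close>

fun enc_table :: "table \<Rightarrow> data" where
  "enc_table Zero = Atom"
| "enc_table (Plus1 f) = Cell Atom (enc_table f)"
| "enc_table (Skip f) = Cell (Cell Atom (enc_table f)) (enc_table f)"
| "enc_table (Branch f g) = Cell (Cell (Cell Atom Atom) (enc_table f)) (enc_table g)"

primrec table_val :: "table \<Rightarrow> 'x list \<Rightarrow> 'x set \<Rightarrow> nat" where
  "table_val Zero X U = 0"
| "table_val (Plus1 f) X U = Suc (table_val f X U)"
| "table_val (Skip f) X U = table_val f (tl X) U"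
| "table_val (Branch f g) X U =
     (if hd X \<in> U then table_val g (tl X) U else table_val f (tl X) U)"

text \<open>The shape invariant behind all running times: \<open>Y\<close> contains the variables at
  which the table may branch, and \<open>n\<close> bounds the number of \<open>Plus1\<close> on a
  path, hence the values.\<close>

primrec fits :: "'x set \<Rightarrow> table \<Rightarrow> 'x list \<Rightarrow> nat \<Rightarrow> bool" where
  "fits Y Zero X n = True"
| "fits Y (Plus1 f) X n = (X = [] \<and> 0 < n \<and> fits Y f [] (n - 1))"
| "fits Y (Skip f) X n = (X \<noteq> [] \<and> fits Y f (tl X) n)"
| "fits Y (Branch f g) X n = (X \<noteq> [] \<and> hd X \<in> Y \<and> fits Y f (tl X) n \<and> fits Y g (tl X) n)"

lemma fits_mono: "fits Y f X n \<Longrightarrow> Y \<subseteq> Y' \<Longrightarrow> n \<le> n' \<Longrightarrow> fits Y' f X n'"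
proof (induction f arbitrary: X n n')
  case (Plus1 f)
  then show ?case using Plus1.IH[of "[]" "n - 1" "n' - 1"] by auto
qed auto

abbreviation cnt :: "'x set \<Rightarrow> 'x list \<Rightarrow> nat" where
  "cnt Y X \<equiv> length (filter (\<lambda>x. x \<in> Y) X)"

section \<open>Pointwise maximum and disjoint convolution of tables\<close>

fun tmax :: "table \<Rightarrow> table \<Rightarrow> table" where
  "tmax Zero g = g"
| "tmax (Plus1 f) Zero = Plus1 f"
| "tmax (Skip f) Zero = Skip f"
| "tmax (Branch f h) Zero = Branch f h"
| "tmax (Plus1 f) (Plus1 g) = Plus1 (tmax f g)"
| "tmax (Skip f) (Skip g) = Skip (tmax f g)"
| "tmax (Skip f) (Branch g h) = Branch (tmax f g) (tmax f h)"
| "tmax (Branch f h) (Skip g) = Branch (tmax f g) (tmax h g)"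
| "tmax (Branch f h) (Branch g k) = Branch (tmax f g) (tmax h k)"

text \<open>At a variable in \<open>U\<close> seen by both tables, one of them receives it:
  \<open>tconv f k\<close> or \<open>tconv h g\<close>. Giving it to neither is never better for
  monotone tables. At \<open>Plus1\<close> the recursion is concatenation of unary numbers. The
  omitted clauses would pair a leaf with an inner node, which two tables fitting the same variable
  list do not do.\<close>

fun tconv :: "table \<Rightarrow> table \<Rightarrow> table" where
  "tconv Zero g = g"
| "tconv (Plus1 f) g = Plus1 (tconv f g)"
| "tconv (Skip f) Zero = Skip f"
| "tconv (Branch f h) Zero = Branch f h"
| "tconv (Skip f) (Skip g) = Skip (tconv f g)"
| "tconv (Skip f) (Branch g h) = Branch (tconv f g) (tconv f h)"
| "tconv (Branch f h) (Skip g) = Branch (tconv f g) (tconv h g)"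
| "tconv (Branch f h) (Branch g k) =
     Branch (tconv f g) (tmax (tconv f k) (tconv h g))"

lemma tconv_Zero [simp]: "tconv f Zero = f"
  by (induction f) auto

lemma fits_tmax: "fits Y f X n \<Longrightarrow> fits Y g X n \<Longrightarrow> fits Y (tmax f g) X n"
  by (induction f g arbitrary: X n rule: tmax.induct) auto

lemma table_val_tmax:
  "fits Y f X n \<Longrightarrow> fits Y' g X n' \<Longrightarrow>
   table_val (tmax f g) X U = max (table_val f X U) (table_val g X U)"
  by (induction f g arbitrary: X n n' rule: tmax.induct) (auto split: if_splits)

lemma fits_tconv:
  "fits Y f X m \<Longrightarrow> fits Z g X n \<Longrightarrow> fits (Y \<union> Z) (tconv f g) X (m + n)"
proof (induction f g arbitrary: X m n rule: tconv.induct)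
  case (2 f g)
  then show ?case using 2(1)[of "[]" "m - 1" n] by auto
qed (auto intro: fits_mono intro!: fits_tmax)

lemma pow_cnt_pos: "1 \<le> (2::nat) ^ cnt Y X"
  by simp

text \<open>One level of the recursion: \<open>s\<close> is the remaining depth and \<open>W\<close>
  the weight of its branchings. Raising \<open>s\<close> by one frees at least
  \<open>100 * W\<close>, which covers the 60 steps of local work.\<close>

lemma tmax_step_bound:
  fixes s W :: nat
  assumes "1 \<le> W"
  shows "a \<le> 100 * s * W \<Longrightarrow> W \<le> W' \<Longrightarrow> a + 60 \<le> 100 * (s + 1) * W'"
    "a \<le> 100 * s * W \<Longrightarrow> b \<le> 100 * s * W \<Longrightarrow> 2 * W \<le> W' \<Longrightarrow> a + b + 60 \<le> 100 * (s + 1) * W'"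
proof -
  have *: "100 * (s + 1) * (k * W) = k * (100 * s * W + 100 * W)" for k
    by (simp add: algebra_simps)
  have m: "100 * (s + 1) * (k * W) \<le> 100 * (s + 1) * W'" if "k * W \<le> W'" for k
    using that by (rule mult_le_mono2)
  show "a \<le> 100 * s * W \<Longrightarrow> W \<le> W' \<Longrightarrow> a + 60 \<le> 100 * (s + 1) * W'"
    using m[of 1, unfolded *] assms by simp
  show "a \<le> 100 * s * W \<Longrightarrow> b \<le> 100 * s * W \<Longrightarrow> 2 * W \<le> W' \<Longrightarrow> a + b + 60 \<le> 100 * (s + 1) * W'"
    using m[of 2, unfolded *] assms by simp
qed

lemma tmax_base_bound: "100 \<le> 100 * (n + length X + 1) * (2::nat) ^ cnt Y X"
  using mult_le_mono[of 100 "100 * (n + length X + 1)" 1 "2 ^ cnt Y X"] by simp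

text \<open>Only variables in \<open>Y\<close> cause two calls, so there are at most
  \<open>2 ^ cnt Y X\<close> paths, each of length at most \<open>n + length X + 1\<close>.\<close>

lemma tmax_computes:
  "fits Y f X n \<Longrightarrow> fits Y g X n \<Longrightarrow>
   computes prog PMAX [enc_table f, enc_table g] (enc_table (tmax f g))
     (100 * (n + length X + 1) * 2 ^ cnt Y X)"
proof (induction f g arbitrary: X n rule: tmax.induct)
  case (5 f g)
  then have X: "X = []" "0 < n" "fits Y f [] (n - 1)" "fits Y g [] (n - 1)" by auto
  then show ?case using computesD[OF 5(1)[OF X(3,4)]]
    by (intro computesI) (auto simp: max_body_def Let_def)
next
  case (6 f g)
  then obtain x X' where X: "X = x # X'" "fits Y f X' n" "fits Y g X' n" by (cases X) auto
  have s: "n + length X + 1 = n + length X' + 1 + 1" using X by simp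
  note c = computesD[OF 6(1)[OF X(2,3)]]
  have W: "(2::nat) ^ cnt Y X' \<le> 2 ^ cnt Y X" by (simp add: X)
  show ?case unfolding s
    \<comment> \<open>The bound given to \<open>computesI\<close> is the actual time of the
      recursive call plus 60; only its comparison with the closed form uses the induction hypothesis
      on the time.\<close>
    apply (rule computes_mono[OF computesI tmax_step_bound(1)[OF pow_cnt_pos c(3) W]])
    using c by (simp_all add: max_body_def Let_def)
next
  case (7 f g h)
  then obtain x X' where X: "X = x # X'" "x \<in> Y" "fits Y f X' n" "fits Y g X' n" "fits Y h X' n"
    by (cases X) auto
  have s: "n + length X + 1 = n + length X' + 1 + 1" using X by simp
  note c = computesD[OF 7(1)[OF X(3,4)]] computesD[OF 7(2)[OF X(3,5)]]
  have W: "(2::nat) * 2 ^ cnt Y X' \<le> 2 ^ cnt Y X" using X(2) by (simp add: X)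
  show ?case unfolding s
    apply (rule computes_mono[OF computesI tmax_step_bound(2)[OF pow_cnt_pos c(3,6) W]])
    using c by (simp_all add: max_body_def Let_def)
next
  case (8 f h g)
  then obtain x X' where X: "X = x # X'" "x \<in> Y" "fits Y f X' n" "fits Y g X' n" "fits Y h X' n"
    by (cases X) auto
  have s: "n + length X + 1 = n + length X' + 1 + 1" using X by simp
  note c = computesD[OF 8(1)[OF X(3,4)]] computesD[OF 8(2)[OF X(5,4)]]
  have W: "(2::nat) * 2 ^ cnt Y X' \<le> 2 ^ cnt Y X" using X(2) by (simp add: X)
  show ?case unfolding s
    apply (rule computes_mono[OF computesI tmax_step_bound(2)[OF pow_cnt_pos c(3,6) W]])
    using c by (simp_all add: max_body_def Let_def)
next
  case (9 f h g k)
  then obtain x X' where X: "X = x # X'" "x \<in> Y" "fits Y f X' n" "fits Y g X' n" "fits Y h X' n"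
    "fits Y k X' n"
    by (cases X) auto
  have s: "n + length X + 1 = n + length X' + 1 + 1" using X by simp
  note c = computesD[OF 9(1)[OF X(3,4)]] computesD[OF 9(2)[OF X(5,6)]]
  have W: "(2::nat) * 2 ^ cnt Y X' \<le> 2 ^ cnt Y X" using X(2) by (simp add: X)
  show ?case unfolding s
    apply (rule computes_mono[OF computesI tmax_step_bound(2)[OF pow_cnt_pos c(3,6) W]])
    using c by (simp_all add: max_body_def Let_def)
next
  case (1 g)
  show ?case by (rule computes_mono[OF computesI tmax_base_bound]) (simp_all add: max_body_def Let_def)
next
  case (2 f)
  show ?case by (rule computes_mono[OF computesI tmax_base_bound]) (simp_all add: max_body_def Let_def)
next
  case (3 f)
  show ?case by (rule computes_mono[OF computesI tmax_base_bound]) (simp_all add: max_body_def Let_def)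
next
  case (4 f h)
  show ?case by (rule computes_mono[OF computesI tmax_base_bound]) (simp_all add: max_body_def Let_def)
qed auto

section \<open>Running time of the convolution\<close>

definition wt :: "'x set \<Rightarrow> 'x set \<Rightarrow> 'x list \<Rightarrow> nat" where
  "wt Y Z X = 3 ^ cnt (Y \<inter> Z) X * 2 ^ cnt (sym_diff Y Z) X"

lemma wt_pos: "1 \<le> wt Y Z X"
  by (simp add: wt_def)

lemma wt_Cons:
  "wt Y Z (x # X) = (if x \<in> Y \<and> x \<in> Z then 3 else if x \<in> Y \<union> Z then 2 else 1) * wt Y Z X"
  by (simp add: wt_def)

text \<open>The maximum taken at a shared variable branches over \<open>Y \<union> Z\<close>; this
  makes its cost comparable with that of the convolutions producing its arguments.\<close>

lemma pow_cnt_le_wt: "2 ^ cnt (Y \<union> Z) X \<le> wt Y Z X"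
proof (induction X)
  case (Cons x X)
  then show ?case unfolding wt_Cons by auto
qed (simp add: wt_def)

lemma conv_Zero_computes:
  "computes prog CONV [enc_table f, Atom] (enc_table f) 10"
  "computes prog CONV [Atom, enc_table f] (enc_table f) 10"
  by (rule computesI; cases f; simp add: conv_body_def Let_def)+

lemmas conv_Zero_simps [simp] = computesD(1,2)[OF conv_Zero_computes(1)]
  computesD(1,2)[OF conv_Zero_computes(2)]

text \<open>The square of the depth comes from the third case, where a maximum of cost
  \<open>100 * s * W\<close> is taken on every level. The difference of
  \<open>(s + 1)\<^sup>2\<close> and \<open>s\<^sup>2\<close> is \<open>2 * s + 1\<close>, enough to
  pay for it.\<close>

lemma step_bound:
  fixes s W :: nat
  assumes "1 \<le> W"
  shows "a \<le> 300 * s\<^sup>2 * W \<Longrightarrow> W \<le> W' \<Longrightarrow> a + 60 \<le> 300 * (s + 1)\<^sup>2 * W'"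
    "a \<le> 300 * s\<^sup>2 * W \<Longrightarrow> b \<le> 300 * s\<^sup>2 * W \<Longrightarrow> 2 * W \<le> W' \<Longrightarrow>
      a + b + 60 \<le> 300 * (s + 1)\<^sup>2 * W'"
    "a \<le> 300 * s\<^sup>2 * W \<Longrightarrow> b \<le> 300 * s\<^sup>2 * W \<Longrightarrow> c \<le> 300 * s\<^sup>2 * W \<Longrightarrow> d \<le> 100 * s * W \<Longrightarrow>
      3 * W \<le> W' \<Longrightarrow> a + b + c + d + 60 \<le> 300 * (s + 1)\<^sup>2 * W'"
proof -
  have *: "300 * (s + 1)\<^sup>2 * (k * W) = k * (300 * s\<^sup>2 * W + 600 * s * W + 300 * W)" for k
    by (simp add: power2_eq_square algebra_simps)
  have m: "300 * (s + 1)\<^sup>2 * (k * W) \<le> 300 * (s + 1)\<^sup>2 * W'" if "k * W \<le> W'" for k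
    using that by (rule mult_le_mono2)
  show "a \<le> 300 * s\<^sup>2 * W \<Longrightarrow> W \<le> W' \<Longrightarrow> a + 60 \<le> 300 * (s + 1)\<^sup>2 * W'"
    using m[of 1, unfolded *] assms by simp
  show "a \<le> 300 * s\<^sup>2 * W \<Longrightarrow> b \<le> 300 * s\<^sup>2 * W \<Longrightarrow> 2 * W \<le> W' \<Longrightarrow>
      a + b + 60 \<le> 300 * (s + 1)\<^sup>2 * W'"
    using m[of 2, unfolded *] assms by simp
  show "a \<le> 300 * s\<^sup>2 * W \<Longrightarrow> b \<le> 300 * s\<^sup>2 * W \<Longrightarrow> c \<le> 300 * s\<^sup>2 * W \<Longrightarrow> d \<le> 100 * s * W \<Longrightarrow>
      3 * W \<le> W' \<Longrightarrow> a + b + c + d + 60 \<le> 300 * (s + 1)\<^sup>2 * W'"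
    using m[of 3, unfolded *] assms by simp
qed

lemma tconv_computes:
  "fits Y f X m \<Longrightarrow> fits Z g X n \<Longrightarrow>
   computes prog CONV [enc_table f, enc_table g] (enc_table (tconv f g))
     (300 * (m + n + length X + 1)\<^sup>2 * wt Y Z X)"
proof (induction f g arbitrary: X m n rule: tconv.induct)
  case (2 f g)
  then have X: "X = []" "0 < m" "fits Y f [] (m - 1)" "fits Z g [] n" by auto
  have s: "m + n + length X + 1 = (m - 1) + n + length ([] :: 'a list) + 1 + 1"
    using X by simp
  note c = computesD[OF 2(1)[OF X(3,4)]]
  have W: "wt Y Z [] \<le> wt Y Z X" by (simp add: X)
  show ?case unfolding s
    apply (rule computes_mono[OF computesI step_bound(1)[OF wt_pos c(3) W]])
    using c X by (cases g; simp add: conv_body_def Let_def)+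
next
  case (5 f g)
  then obtain x X' where X: "X = x # X'" "fits Y f X' m" "fits Z g X' n" by (cases X) auto
  have s: "m + n + length X + 1 = m + n + length X' + 1 + 1" using X by simp
  note c = computesD[OF 5(1)[OF X(2,3)]]
  have W: "wt Y Z X' \<le> wt Y Z X" using wt_pos[of Y Z X'] by (simp add: X wt_Cons)
  show ?case unfolding s
    apply (rule computes_mono[OF computesI step_bound(1)[OF wt_pos c(3) W]])
    using c by (simp_all add: conv_body_def Let_def)
next
  case (6 f g h)
  then obtain x X' where X: "X = x # X'" "x \<in> Z" "fits Y f X' m" "fits Z g X' n" "fits Z h X' n"
    by (cases X) auto
  have s: "m + n + length X + 1 = m + n + length X' + 1 + 1" using X by simp
  note c = computesD[OF 6(1)[OF X(3,4)]] computesD[OF 6(2)[OF X(3,5)]]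
  have W: "2 * wt Y Z X' \<le> wt Y Z X" using X(2) by (simp add: X wt_Cons)
  show ?case unfolding s
    apply (rule computes_mono[OF computesI step_bound(2)[OF wt_pos c(3,6) W]])
    using c by (simp_all add: conv_body_def Let_def)
next
  case (7 f h g)
  then obtain x X' where X: "X = x # X'" "x \<in> Y" "fits Y f X' m" "fits Z g X' n" "fits Y h X' m"
    by (cases X) auto
  have s: "m + n + length X + 1 = m + n + length X' + 1 + 1" using X by simp
  note c = computesD[OF 7(1)[OF X(3,4)]] computesD[OF 7(2)[OF X(5,4)]]
  have W: "2 * wt Y Z X' \<le> wt Y Z X" using X(2) by (simp add: X wt_Cons)
  show ?case unfolding s
    apply (rule computes_mono[OF computesI step_bound(2)[OF wt_pos c(3,6) W]])
    using c by (simp_all add: conv_body_def Let_def)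
next
  case (8 f h g k)
  then obtain x X' where X: "X = x # X'" "x \<in> Y" "x \<in> Z" "fits Y f X' m" "fits Z g X' n"
    "fits Y h X' m" "fits Z k X' n"
    by (cases X) auto
  have s: "m + n + length X + 1 = m + n + length X' + 1 + 1" using X by simp
  note c = computesD[OF 8(1)[OF X(4,5)]] computesD[OF 8(2)[OF X(4,7)]] computesD[OF 8(3)[OF X(6,5)]]
  note d = computesD[OF tmax_computes[OF fits_tconv[OF X(4,7)] fits_tconv[OF X(6,5)]]]
  have "100 * (m + n + length X' + 1) * 2 ^ cnt (Y \<union> Z) X' \<le>
      100 * (m + n + length X' + 1) * wt Y Z X'"
    by (rule mult_le_mono2[OF pow_cnt_le_wt])
  note d3 = order.trans[OF d(3) this]
  have W: "3 * wt Y Z X' \<le> wt Y Z X" using X(2,3) by (simp add: X wt_Cons)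
  show ?case unfolding s
    apply (rule computes_mono[OF computesI step_bound(3)[OF wt_pos c(3,6,9) d3 W]])
    using c d by (simp_all add: conv_body_def Let_def)
next
  case (1 g)
  have "60 \<le> 300 * (m + n + length X + 1)\<^sup>2 * wt Y Z X"
    using mult_le_mono[of 300 "300 * (m + n + length X + 1)\<^sup>2" 1 "wt Y Z X"] wt_pos[of Y Z X] by simp
  then show ?case using computes_mono[OF conv_Zero_computes(2)[of g]] by simp
next
  case (3 f)
  have "60 \<le> 300 * (m + n + length X + 1)\<^sup>2 * wt Y Z X"
    using mult_le_mono[of 300 "300 * (m + n + length X + 1)\<^sup>2" 1 "wt Y Z X"] wt_pos[of Y Z X] by simp
  then show ?case using computes_mono[OF conv_Zero_computes(1)[of "Skip f"]] by simp
next
  case (4 f h)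
  have "60 \<le> 300 * (m + n + length X + 1)\<^sup>2 * wt Y Z X"
    using mult_le_mono[of 300 "300 * (m + n + length X + 1)\<^sup>2" 1 "wt Y Z X"] wt_pos[of Y Z X] by simp
  then show ?case using computes_mono[OF conv_Zero_computes(1)[of "Branch f h"]] by simp
qed auto

section \<open>Table operations along the decomposition\<close>

definition bag_vars :: "nat list \<Rightarrow> var set" where
  "bag_vars b = set b \<times> UNIV"

definition slots :: "tedge \<Rightarrow> var set" where
  "slots e = ends e \<times> set (snd e)"

primrec res :: "nat list \<Rightarrow> table \<Rightarrow> var list \<Rightarrow> table" where
  "res b Zero X = Zero"
| "res b (Plus1 f) X = Plus1 f"
| "res b (Skip f) X = Skip (res b f (tl X))"
| "res b (Branch f g) X =
     (if hd X \<in> bag_vars b then Branch (res b f (tl X)) (res b g (tl X)) else Skip (res b g (tl X)))"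

fun edge_table :: "tedge \<Rightarrow> var list \<Rightarrow> table" where
  "edge_table e [] = Plus1 Zero"
| "edge_table e (x # X) =
     (if x \<in> slots e then Branch Zero (edge_table e X) else Skip (edge_table e X))"

fun add_edges :: "nat list \<Rightarrow> tedge list \<Rightarrow> var list \<Rightarrow> table \<Rightarrow> table" where
  "add_edges b [] X f = f"
| "add_edges b (e # es) X f =
     add_edges b es X (if ends e \<subseteq> set b then tconv f (edge_table e X) else f)"

text \<open>One accumulated table over \<open>b\<close> is threaded through all children, so
  arbitrary branching needs only joins of a table over \<open>b\<close> with one restricted to the
  common part of two bags. For \<open>set l \<subseteq> set b\<close> the list \<open>cs\<close> is
  absorbed into the same table as if its trees were children of \<open>b\<close>.\<close>

fun absorb :: "var list \<Rightarrow> tedge list \<Rightarrow> nat list \<Rightarrow> table \<Rightarrow> nat list rtree list \<Rightarrow> table" where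
  "absorb X es b f [] = f"
| "absorb X es b f (RNode l cs # ts) =
     absorb X es b
       (if set l \<subseteq> set b then absorb X es b f cs
        else tconv f (res b (absorb X es l (add_edges l es X Zero) cs) X))
       ts"

lemma fits_Nil: "fits Y f [] n \<Longrightarrow> fits Z f [] n"
  by (induction f arbitrary: n) auto

lemma fits_res: "fits Y f X n \<Longrightarrow> fits (bag_vars b \<inter> Y) (res b f X) X n"
  by (induction f arbitrary: X n) (auto intro: fits_Nil)

lemma fits_edge_table: "fits (slots e) (edge_table e X) X 1"
  by (induction X) auto

lemma tconv_edge_table_fits:
  assumes "fits Y f X n" "slots e \<inter> set X \<subseteq> Y"
  shows "fits Y (tconv f (edge_table e X)) X (n + 1)"
proof -
  have "fits Y (edge_table e X) X 1"
    using assms(2) by (induction X) auto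
  from fits_tconv[OF assms(1) this] show ?thesis by simp
qed

lemma add_edges_fits:
  "fits (bag_vars b) f X n \<Longrightarrow> fits (bag_vars b) (add_edges b es X f) X (n + length es)"
proof (induction es arbitrary: f n)
  case (Cons e es)
  have "fits (bag_vars b) (if ends e \<subseteq> set b then tconv f (edge_table e X) else f) X (n + 1)"
  proof (cases "ends e \<subseteq> set b")
    case True
    then have "slots e \<inter> set X \<subseteq> bag_vars b" by (auto simp: slots_def bag_vars_def)
    then show ?thesis using tconv_edge_table_fits[OF Cons.prems] True by simp
  next
    case False
    then show ?thesis using Cons.prems by (auto intro: fits_mono)
  qed
  from Cons.IH[OF this] show ?case by simp
qed simp

primrec nodes :: "'a rtree \<Rightarrow> nat" where
  "nodes (RNode l cs) = Suc (sum_list (map nodes cs))"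

lemma absorb_fits:
  "fits (bag_vars b) f X n \<Longrightarrow>
   fits (bag_vars b) (absorb X es b f ts) X (n + sum_list (map nodes ts) * length es)"
proof (induction X es b f ts arbitrary: n rule: absorb.induct)
  case (1 X es b f)
  then show ?case by simp
next
  case (2 X es b f l cs ts)
  let ?k = "sum_list (map nodes cs)" and ?E = "length es"
  have "fits (bag_vars b) (if set l \<subseteq> set b then absorb X es b f cs
        else tconv f (res b (absorb X es l (add_edges l es X Zero) cs) X)) X (n + Suc ?k * ?E)"
  proof (cases "set l \<subseteq> set b")
    case True
    then show ?thesis using fits_mono[OF 2(1)[OF True 2(4)] order.refl, of "n + Suc ?k * ?E"] by simp
  next
    case False
    have "fits (bag_vars l) (add_edges l es X Zero) X ?E"
      using add_edges_fits[of l Zero X 0 es] by simp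
    from fits_res[OF 2(2)[OF False this], of b]
    have "fits (bag_vars b \<inter> bag_vars l) (res b (absorb X es l (add_edges l es X Zero) cs) X) X
        (Suc ?k * ?E)" by simp
    from fits_tconv[OF 2(4) this] show ?thesis using False by (simp add: Un_absorb2)
  qed
  from 2(3)[OF this] show ?case by (simp add: algebra_simps)
qed

subsection \<open>Running times\<close>

text \<open>The analogue of the earlier step bounds for a local cost \<open>K\<close> that depends
  on the bag and is therefore kept as a factor.\<close>

lemma linear_step_bound:
  fixes s W K :: nat
  assumes "1 \<le> W"
  shows "a \<le> s * W * K \<Longrightarrow> W \<le> W' \<Longrightarrow> a + K \<le> (s + 1) * W' * K"
    "a \<le> s * W * K \<Longrightarrow> b \<le> s * W * K \<Longrightarrow> 2 * W \<le> W' \<Longrightarrow> a + b + K \<le> (s + 1) * W' * K"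
proof -
  have W: "K \<le> W * K" using assms by simp
  have *: "(s + 1) * (k * W) * K = k * (s * W * K + W * K)" for k
    by (simp add: algebra_simps)
  have m: "(s + 1) * (k * W) * K \<le> (s + 1) * W' * K" if "k * W \<le> W'" for k
    using that by (intro mult_le_mono) auto
  show "a + K \<le> (s + 1) * W' * K" if "a \<le> s * W * K" "W \<le> W'"
    using m[of 1, unfolded *, unfolded mult_1, OF that(2)] W that(1) by linarith
  show "a + b + K \<le> (s + 1) * W' * K" if "a \<le> s * W * K" "b \<le> s * W * K" "2 * W \<le> W'"
  proof (rule order.trans[OF _ m[of 2, unfolded *, OF that(3)]])
    show "a + b + K \<le> 2 * (s * W * K + W * K)"
      by (rule order.trans[OF add_mono[OF add_mono[OF that(1,2)] W]]) simp
  qed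
qed

lemma mem_nats_computes:
  "computes prog MEM [enc_nat x, enc_nats l] (enc_bool (x \<in> set l)) (100 * size (enc_nats l) + 40)"
  using mem_computes[of "enc_nat x" "map enc_nat l"]
  by (simp add: enc_nats_def inj_image_mem_iff[OF inj_enc_nat])

lemmas mem_nats_simps [simp] = computesD(1,2)[OF mem_nats_computes]
lemmas mem_nats_time = computesD(3)[OF mem_nats_computes]

lemma sub_nats_computes:
  "computes prog SUB [enc_nats a, enc_nats b] (enc_bool (set a \<subseteq> set b))
     ((length a + 1) * (100 * size (enc_nats b) + 60))"
proof -
  have "enc_nat ` set a \<subseteq> enc_nat ` set b \<longleftrightarrow> set a \<subseteq> set b" by auto
  then show ?thesis
    using sub_computes[of "map enc_nat a" "map enc_nat b"] by (simp add: enc_nats_def)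
qed

lemma res_base_bound: "20 \<le> (length X + 1) * 2 ^ cnt Y X * (100 * n + 100)"
proof -
  have "0 < (length X + 1) * (2::nat) ^ cnt Y X" by simp
  then have "1 * 20 \<le> (length X + 1) * 2 ^ cnt Y X * (100 * n + 100)"
    by (intro mult_le_mono) linarith+
  then show ?thesis by (simp only: mult_1)
qed

lemma res_computes:
  "fits Y f X n \<Longrightarrow>
   computes prog RES [enc_nats b, enc_vars X, enc_table f] (enc_table (res b f X))
     ((length X + 1) * 2 ^ cnt Y X * (100 * size (enc_nats b) + 100))"
proof (induction f arbitrary: X n)

  case Zero
  show ?case by (rule computes_mono[OF computesI res_base_bound]) (simp_all add: res_body_def Let_def)
next
  case (Plus1 f)
  show ?case by (rule computes_mono[OF computesI res_base_bound]) (simp_all add: res_body_def Let_def)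
next
  case (Skip f)
  then obtain v t X' where X: "X = (v, t) # X'" "fits Y f X' n" by (cases X) auto
  have s: "length X + 1 = length X' + 1 + 1" using X by simp
  note c = computesD[OF Skip(1)[OF X(2)]]
  have W: "(2::nat) ^ cnt Y X' \<le> 2 ^ cnt Y X" by (simp add: X)
  show ?case unfolding s
    apply (rule computes_mono[OF computesI linear_step_bound(1)[OF pow_cnt_pos c(3) W]])
    using c by (simp_all add: res_body_def Let_def X)
next
  case (Branch f g)
  then obtain v t X' where X: "X = (v, t) # X'" "(v, t) \<in> Y" "fits Y f X' n" "fits Y g X' n"
    by (cases X) auto
  have s: "length X + 1 = length X' + 1 + 1" using X by simp
  note c = computesD[OF Branch(1)[OF X(3)]] computesD[OF Branch(2)[OF X(4)]]
  have W: "(2::nat) * 2 ^ cnt Y X' \<le> 2 ^ cnt Y X" using X(2) by (simp add: X)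
  show ?case unfolding s
    apply (rule computes_mono[OF computesI linear_step_bound(2)[OF pow_cnt_pos c(3,6) W]])
    using c mem_nats_time[of v b]
    by (simp_all add: res_body_def Let_def X bag_vars_def)
qed

lemma edge_computes:
  "computes prog EDGE [enc_tedge e, enc_vars X] (enc_table (edge_table e X))
     ((length X + 1) * (100 * size (enc_tedge e) + 250))"
proof (induction X)
  case Nil
  obtain u u' ls where e: "e = ((u, u'), ls)" by (metis prod.collapse)
  show ?case by (rule computesI) (simp_all add: edge_body_def e)
next
  case (Cons x X)
  obtain u u' ls where e: "e = ((u, u'), ls)" by (metis prod.collapse)
  obtain v t where x: "x = (v, t)" by fastforce
  show ?case
    using computesD[OF Cons] eq_time[of "enc_nat v" "enc_nat u"] eq_time[of "enc_nat v" "enc_nat u'"]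
      mem_nats_time[of t ls]
    by (intro computesI; cases "v = u"; cases "v = u'"; cases "t \<in> set ls")
      (simp_all add: edge_body_def e x slots_def)
qed

text \<open>The general bound would charge a factor 3 for every pair over the two ends, hence
  \<open>9 ^ k\<close> for a bag of two vertices. Here the left subtable at a pair of
  \<open>e\<close> is \<open>Zero\<close>, so one convolution and one maximum remain, and the factor
  is 2.\<close>

lemma conv_edge_computes:
  "fits Y f X n \<Longrightarrow> slots e \<inter> set X \<subseteq> Y \<Longrightarrow>
   computes prog CONV [enc_table f, enc_table (edge_table e X)] (enc_table (tconv f (edge_table e X)))
     (300 * (n + 1 + length X + 1)\<^sup>2 * 2 ^ cnt Y X)"
proof (induction X arbitrary: f)
  case Nil
  have "fits Y (edge_table e []) [] 1" by simp
  from tconv_computes[OF Nil(1) this] show ?case by (simp add: wt_def)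
next
  case (Cons x X)
  have IH: "computes prog CONV [enc_table f, enc_table (edge_table e X)]
      (enc_table (tconv f (edge_table e X))) (300 * (n + 1 + length X + 1)\<^sup>2 * 2 ^ cnt Y X)"
    if "fits Y f X n" for f using Cons.prems(2) by (intro Cons.IH[OF that]) auto
  have s: "n + 1 + length (x # X) + 1 = n + 1 + length X + 1 + 1" by simp
  have W1: "(2::nat) ^ cnt Y X \<le> 2 ^ cnt Y (x # X)" by simp
  have W2: "(2::nat) * 2 ^ cnt Y X \<le> 2 ^ cnt Y (x # X)" if "x \<in> Y" using that by simp
  have base: "60 \<le> 300 * (n + 1 + length (x # X) + 1)\<^sup>2 * (2::nat) ^ cnt Y (x # X)"
    using mult_le_mono[of 300 "300 * (n + 1 + length (x # X) + 1)\<^sup>2" 1 "2 ^ cnt Y (x # X)"] by simp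
  have sl: "x \<in> Y" if "x \<in> slots e" using Cons.prems(2) that by auto
  show ?case
  proof (cases f)
    case Zero
    show ?thesis using computes_mono[OF conv_Zero_computes(2)] base by (simp add: Zero)
  next
    case (Plus1 g)
    then show ?thesis using Cons.prems by simp
  next
    case (Skip g)
    then have g: "fits Y g X n" using Cons.prems by simp
    note c = computesD[OF IH[OF g]]
    show ?thesis
    proof (cases "x \<in> slots e")
      case True
      show ?thesis unfolding s
        apply (rule computes_mono[OF computesI step_bound(1)[OF pow_cnt_pos c(3) W1]])
        using c True conv_Zero_computes(1)[of g, THEN computesD(3)]
        by (simp_all add: conv_body_def Let_def Skip)
    next
      case False
      show ?thesis unfolding s
        apply (rule computes_mono[OF computesI step_bound(1)[OF pow_cnt_pos c(3) W1]])
        using c False by (simp_all add: conv_body_def Let_def Skip)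
    qed
  next
    case (Branch g h)
    then have g: "fits Y g X n" "fits Y h X n" "x \<in> Y" using Cons.prems by auto
    note c = computesD[OF IH[OF g(1)]] computesD[OF IH[OF g(2)]]
    show ?thesis
    proof (cases "x \<in> slots e")
      case True
      have "fits Y (tconv g (edge_table e X)) X (n + 1)" "fits Y h X (n + 1)"
        using tconv_edge_table_fits[OF g(1), of e] Cons.prems(2) fits_mono[OF g(2), of Y "n + 1"]
        by auto
      note m = computesD[OF tmax_computes[OF this]]
      \<comment> \<open>The maximum takes the place of the second recursive call in the step
        bound.\<close>
      have "100 * (n + 1 + length X + 1) * 2 ^ cnt Y X \<le> 300 * (n + 1 + length X + 1)\<^sup>2 * (2::nat) ^ cnt Y X"
        by (intro mult_le_mono) (auto simp: power2_eq_square)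
      note m3 = order.trans[OF m(3) this]
      show ?thesis unfolding s
        apply (rule computes_mono[OF computesI step_bound(2)[OF pow_cnt_pos c(3) m3 W2[OF g(3)]]])
        using c m True conv_Zero_computes(1)[of g, THEN computesD(3)]
          conv_Zero_computes(1)[of h, THEN computesD(3)]
        by (simp_all add: conv_body_def Let_def Branch)
    next
      case False
      show ?thesis unfolding s
        apply (rule computes_mono[OF computesI step_bound(2)[OF pow_cnt_pos c(3,6) W2[OF g(3)]]])
        using c False by (simp_all add: conv_body_def Let_def Branch)
    qed
  qed
qed

text \<open>Cost per edge: a convolution, the construction of the edge table, and two membership
  tests with local work. \<open>N\<close> bounds encoding sizes, \<open>H\<close> the unary values,
  \<open>L\<close> the number of variables and \<open>Q\<close> the branching.\<close>

definition add_bound :: "nat \<Rightarrow> nat \<Rightarrow> nat \<Rightarrow> nat \<Rightarrow> nat" where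
  "add_bound N H L Q = 300 * (H + L + 2)\<^sup>2 * Q + (L + 1) * (100 * N + 250) + 200 * N + 200"

lemma add_computes:
  assumes "size (enc_nats b) \<le> N" "2 ^ cnt (bag_vars b) X \<le> Q"
  shows "\<forall>e\<in>set es. size (enc_tedge e) \<le> N \<Longrightarrow> fits (bag_vars b) f X n \<Longrightarrow> n + length es \<le> H \<Longrightarrow>
   computes prog ADD [enc_nats b, enc_list (map enc_tedge es), enc_vars X, enc_table f]
     (enc_table (add_edges b es X f)) ((length es + 1) * add_bound N H (length X) Q)"
proof (induction es arbitrary: f n)
  case Nil
  show ?case by (rule computesI) (simp_all add: add_body_def add_bound_def)
next
  case (Cons e es)
  obtain u v ls where e: "e = ((u, v), ls)" by (metis prod.collapse)
  let ?f = "if ends e \<subseteq> set b then tconv f (edge_table e X) else f"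
  have f: "fits (bag_vars b) ?f X (n + 1)"
    using add_edges_fits[OF Cons.prems(2), of "[e]"] by simp
  note IH = computesD[OF Cons.IH[OF _ f]]
  have IH': "fun_ok prog ADD [enc_nats b, enc_list (map enc_tedge es), enc_vars X, enc_table ?f]"
    "fun_val prog ADD [enc_nats b, enc_list (map enc_tedge es), enc_vars X, enc_table ?f] =
      enc_table (add_edges b es X ?f)"
    "fun_time prog ADD [enc_nats b, enc_list (map enc_tedge es), enc_vars X, enc_table ?f] \<le>
      (length es + 1) * add_bound N H (length X) Q"
    using IH Cons.prems by simp_all
  have mem: "fun_time prog MEM [enc_nat w, enc_nats b] \<le> 100 * N + 40" for w
    using mem_nats_time[of w b] assms(1) by simp
  have ed: "fun_time prog EDGE [enc_tedge e, enc_vars X] \<le> (length X + 1) * (100 * N + 250)"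
    by (rule order.trans[OF computesD(3)[OF edge_computes]], rule mult_le_mono2) (use Cons.prems in simp)
  have B: "300 * (H + length X + 2)\<^sup>2 * Q + (length X + 1) * (100 * N + 250) + 200 * N + 200
      \<le> add_bound N H (length X) Q"
    by (simp add: add_bound_def)
  show ?case
  proof (cases "ends e \<subseteq> set b")
    case True
    then have "slots e \<inter> set X \<subseteq> bag_vars b" by (auto simp: slots_def bag_vars_def)
    note c = computesD[OF conv_edge_computes[OF Cons.prems(2) this]]
    have "300 * (n + 1 + length X + 1)\<^sup>2 * 2 ^ cnt (bag_vars b) X \<le> 300 * (H + length X + 2)\<^sup>2 * Q"
      using Cons.prems assms by (intro mult_le_mono power_mono) auto
    then have c3: "fun_time prog CONV [enc_table f, enc_table (edge_table e X)] \<le>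
        300 * (H + length X + 2)\<^sup>2 * Q"
      using c(3) by linarith
    show ?thesis
      using IH' c(1,2) c3 computesD(1,2)[OF edge_computes[of e X]] ed mem[of u] mem[of v] True B
      by (intro computesI) (simp_all add: add_body_def e)
  next
    case False
    then show ?thesis
      using IH' mem[of u] mem[of v] B
      by (intro computesI; cases "u \<in> set b"; cases "v \<in> set b") (simp_all add: add_body_def e)
  qed
qed

text \<open>Cost per node: the inclusion test of the bags, the join, the restriction of the child
  table, the addition of up to \<open>N\<close> edges, and local work.\<close>

definition node_bound :: "nat \<Rightarrow> nat \<Rightarrow> nat \<Rightarrow> nat \<Rightarrow> nat" where
  "node_bound N H L Q = (N + 1) * (100 * N + 60) + 300 * (H + L + 1)\<^sup>2 * Q +
     (L + 1) * Q * (100 * N + 100) + (N + 1) * add_bound N H L Q + 100"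



text \<open>The recursion changes the current bag, so the bounds are assumed for a whole family
  \<open>BB\<close>. The weight of a join is assumed only for
  \<open>\<not> set l \<subseteq> set b\<close>, the case in which a join takes place. Each node of
  the forest is charged once.\<close>

lemma absorb_computes:
  assumes bags: "\<And>b. b \<in> BB \<Longrightarrow> size (enc_nats b) \<le> N"
      "\<And>b. b \<in> BB \<Longrightarrow> 2 ^ cnt (bag_vars b) X \<le> Q"
      "\<And>b l. b \<in> BB \<Longrightarrow> l \<in> BB \<Longrightarrow> \<not> set l \<subseteq> set b \<Longrightarrow> wt (bag_vars b) (bag_vars b \<inter> bag_vars l) X \<le> Q"
    and es: "\<forall>e\<in>set es. size (enc_tedge e) \<le> N" "length es \<le> N"
  shows "fits (bag_vars b) f X n \<Longrightarrow> n + sum_list (map nodes ts) * length es \<le> H \<Longrightarrow>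
    b \<in> BB \<Longrightarrow> (\<forall>t\<in>set ts. set_rtree t \<subseteq> BB) \<Longrightarrow>
    computes prog ABSORB
      [enc_nats b, enc_table f, enc_list (map enc_rtree ts), enc_vars X, enc_list (map enc_tedge es)]
      (enc_table (absorb X es b f ts))
      (sum_list (map nodes ts) * node_bound N H (length X) Q + 20)"
  using assms
proof (induction X es b f ts arbitrary: n rule: absorb.induct)
  case (1 X es b f)
  show ?case by (rule computesI) (simp_all add: absorb_body_def add_mult_distrib)
next
  case (2 X es b f l cs ts)
  let ?G = "node_bound N H (length X) Q" and ?k = "sum_list (map nodes cs)" and ?E = "length es"
  let ?m = "sum_list (map nodes ts)"
  let ?call = "\<lambda>b f ts. [enc_nats b, enc_table f, enc_list (map enc_rtree ts), enc_vars X,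
      enc_list (map enc_tedge es)]"
  let ?a = "add_edges l es X Zero"
  let ?g = "absorb X es l ?a cs"
  let ?r = "res b ?g X"
  let ?f = "if set l \<subseteq> set b then absorb X es b f cs else tconv f ?r"
  note f = 2(4) and b = 2(6)
  have l: "l \<in> BB" and cs: "\<forall>t\<in>set cs. set_rtree t \<subseteq> BB" and ts: "\<forall>t\<in>set ts. set_rtree t \<subseteq> BB"
    using 2(7) by auto
  have H: "n + Suc ?k * ?E + ?m * ?E \<le> H"
    using 2(5) by (simp add: algebra_simps)
  have fits: "fits (bag_vars b) ?f X (n + Suc ?k * ?E)"
    using absorb_fits[OF f, of es "[RNode l cs]"] by simp
  have rest: "computes prog ABSORB (?call b ?f ts) (enc_table (absorb X es b ?f ts)) (?m * ?G + 20)"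
    using 2(3)[OF fits H b ts 2(8-12)] .
  have size_l: "length l \<le> N"
    using length_le_size_enc_list[of "map enc_nat l"] 2(8)[OF l] by (simp add: enc_nats_def)
  have "(length l + 1) * (100 * size (enc_nats b) + 60) \<le> (N + 1) * (100 * N + 60)"
    by (intro mult_le_mono) (use size_l 2(8)[OF b] in auto)
  then have sub: "computes prog SUB [enc_nats l, enc_nats b] (enc_bool (set l \<subseteq> set b))
      ((N + 1) * (100 * N + 60))"
    using sub_nats_computes computes_mono by blast
  let ?A = "(N + 1) * (100 * N + 60)" and ?C = "300 * (H + length X + 1)\<^sup>2 * Q"
  let ?R = "(length X + 1) * Q * (100 * N + 100)"
  let ?D = "(N + 1) * add_bound N H (length X) Q"
  have G: "?A + ?C + ?R + ?D + 100 = ?G" by (simp add: node_bound_def)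
  show ?case
  proof (cases "set l \<subseteq> set b")
    case True
    have "n + ?k * ?E \<le> H" using H by simp
    note c = 2(1)[OF True f this b cs 2(8-12)]
    show ?thesis using computesD[OF rest] computesD[OF c] computesD[OF sub] True G
      by (intro computesI) (simp_all add: absorb_body_def add_mult_distrib)
  next
    case False
    have "fits (bag_vars l) Zero X 0" by simp
    note add = add_computes[OF 2(8)[OF l] 2(9)[OF l] 2(11) this, of H]
    have "?E \<le> H" using H by simp
    then have add: "computes prog ADD [enc_nats l, enc_list (map enc_tedge es), enc_vars X, Atom]
        (enc_table ?a) ?D"
      using computes_mono[OF add] 2(12) by simp
    have a: "fits (bag_vars l) ?a X ?E" using add_edges_fits[of l Zero X 0 es] by simp
    have "?E + ?k * ?E \<le> H" using H by simp
    note c = 2(2)[OF False a this l cs 2(8-12)]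
    have g: "fits (bag_vars l) ?g X (Suc ?k * ?E)" using absorb_fits[OF a, of es cs] by simp
    have "(length X + 1) * 2 ^ cnt (bag_vars l) X * (100 * size (enc_nats b) + 100) \<le> ?R"
      by (intro mult_le_mono) (use 2(8)[OF b] 2(9)[OF l] in auto)
    note r = computes_mono[OF res_computes[OF g] this]
    have "300 * (n + Suc ?k * ?E + length X + 1)\<^sup>2 * wt (bag_vars b) (bag_vars b \<inter> bag_vars l) X \<le> ?C"
      by (intro mult_le_mono power_mono) (use H 2(10)[OF b l False] in auto)
    note v = computes_mono[OF tconv_computes[OF f fits_res[OF g]] this]
    show ?thesis
      using computesD[OF rest] computesD[OF c] computesD[OF sub] computesD[OF add] computesD[OF r]
        computesD[OF v] False G
      by (intro computesI) (simp_all add: absorb_body_def add_mult_distrib)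
  qed
qed

section \<open>Conversion of the result to binary\<close>

lemma inc_computes: "computes prog INC [enc_nat n] (enc_nat (Suc n)) (20 * n + 20)"
proof (induction n rule: less_induct)
  case (less n)
  show ?case
  proof (cases "n = 0")
    case True
    have "enc_nat 0 = Atom" "enc_nat 1 = Cell (Cell Atom Atom) Atom"
      by (simp_all add: enc_nat.simps)
    then show ?thesis by (intro computesI) (simp_all add: True inc_body_def)
  next
    case n: False
    show ?thesis
    proof (cases "odd n")
      case True
      have e: "enc_nat n = Cell (Cell Atom Atom) (enc_nat (n div 2))"
        "enc_nat (Suc n) = Cell Atom (enc_nat (Suc (n div 2)))"
        using True n by (subst enc_nat.simps; simp)+
      show ?thesis using computesD[OF less[of "n div 2"]] n
        by (intro computesI) (simp_all add: e inc_body_def)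
    next
      case False
      have e: "enc_nat n = Cell Atom (enc_nat (n div 2))"
        "enc_nat (Suc n) = Cell (Cell Atom Atom) (enc_nat (n div 2))"
        using False n by (subst enc_nat.simps; simp)+
      show ?thesis by (intro computesI) (simp_all add: e inc_body_def)
    qed
  qed
qed

text \<open>With no visible variable there is no \<open>Branch\<close>: the table is a chain of
  \<open>Skip\<close> followed by a unary number. The crude linear bound for an increment suffices
  because values are at most \<open>n\<close>.\<close>

lemma bin_computes:
  "fits {} f X n \<Longrightarrow>
   computes prog BIN [enc_table f] (enc_nat (table_val f X {})) ((n + length X + 1) * (20 * n + 60))"
proof (induction f arbitrary: X n)
  case Zero
  have "enc_nat 0 = Atom" by (simp add: enc_nat.simps)
  then show ?case by (intro computesI) (simp_all add: bin_body_def)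
next
  case (Plus1 f)
  from Plus1.prems obtain m where m: "n = Suc m" "X = []" "fits {} f X m" by (cases n) auto
  have "table_val f X {} \<le> m"
    using m(2,3)
  proof (induction f arbitrary: m)
    case (Plus1 f)
    then show ?case using Plus1.IH[of "m - 1"] by (cases m) auto
  qed auto
  then show ?case
    using computesD[OF Plus1(1)[OF m(3)]] computesD[OF inc_computes[of "table_val f X {}"]] m(1,2)
    by (intro computesI) (simp_all add: bin_body_def algebra_simps)
next
  case (Skip f)
  then obtain x X' where X: "X = x # X'" "fits {} f X' n" by (cases X) auto
  show ?case using computesD[OF Skip(1)[OF X(2)]]
    by (intro computesI) (simp_all add: bin_body_def X)
qed auto

section \<open>Correctness of the tables\<close>

lemma table_val_cong:
  "fits Y f X n \<Longrightarrow> U \<inter> set X = U' \<inter> set X \<Longrightarrow> table_val f X U = table_val f X U'"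
proof (induction f arbitrary: X n)
  case (Skip f)
  then show ?case by (cases X) auto
next
  case (Branch f g)
  then obtain x X' where X: "X = x # X'" "fits Y f X' n" "fits Y g X' n" by (cases X) auto
  have "U \<inter> set X' = U' \<inter> set X'" "x \<in> U \<longleftrightarrow> x \<in> U'" using Branch.prems(2) X(1) by auto
  then show ?case using Branch.IH X by auto
qed auto

text \<open>Deleting \<open>x\<close> from the argument reads the left subtable and inserting it
  reads the right one, while neither subtable notices the change as
  \<open>x \<notin> set X\<close>.\<close>

lemma mono_Branch:
  assumes "fits Y f X n" "fits Y g X n" "x \<notin> set X" "mono (table_val (Branch f g) (x # X))"
  shows "mono (table_val f X)" "mono (table_val g X)" "table_val f X U \<le> table_val g X U"
proof -
  have rem: "table_val f X (U - {x}) = table_val f X U" "table_val g X (insert x U) = table_val g X U"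
    for U
    using assms(3) by (intro table_val_cong[OF assms(1)] table_val_cong[OF assms(2)]; auto)+
  show "mono (table_val f X)"
  proof (rule monoI)
    fix U U' :: "'a set" assume "U \<subseteq> U'"
    then have "U - {x} \<subseteq> U' - {x}" by blast
    from monoD[OF assms(4) this] show "table_val f X U \<le> table_val f X U'" by (simp add: rem)
  qed
  show "mono (table_val g X)"
  proof (rule monoI)
    fix U U' :: "'a set" assume "U \<subseteq> U'"
    then have "insert x U \<subseteq> insert x U'" by blast
    from monoD[OF assms(4) this] show "table_val g X U \<le> table_val g X U'" by (simp add: rem)
  qed
  have "U - {x} \<subseteq> insert x U" by blast
  from monoD[OF assms(4) this] show "table_val f X U \<le> table_val g X U" by (simp add: rem)
qed

lemma mono_Skip: "mono (table_val (Skip f) (x # X)) \<Longrightarrow> mono (table_val f X)"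
  by (simp add: mono_def)

text \<open>The convolution need not follow the given split: a variable of \<open>U\<close> seen by
  one table goes to that table even if its part of the split omits it. Monotonicity, in the form
  that left values are at most right values, shows that this only helps.\<close>

lemma table_val_tconv_ge:
  "fits Y f X m \<Longrightarrow> fits Z g X n \<Longrightarrow> distinct X \<Longrightarrow>
   mono (table_val f X) \<Longrightarrow> mono (table_val g X) \<Longrightarrow> U1 \<inter> U2 = {} \<Longrightarrow> U1 \<subseteq> U \<Longrightarrow> U2 \<subseteq> U \<Longrightarrow>
   table_val f X U1 + table_val g X U2 \<le> table_val (tconv f g) X U"
proof (induction f g arbitrary: X m n rule: tconv.induct)
  case (1 g)
  then show ?case by (simp add: monoD)
next
  case (2 f g)
  then have "mono (table_val f X)" by (simp add: mono_def)
  then show ?case using 2 by auto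
next
  case (3 f)
  then show ?case using monoD[OF 3(4,7)] by simp
next
  case (4 f h)
  then show ?case using monoD[OF 4(4,7)] by simp
next
  case (5 f g)
  then obtain x X' where X: "X = x # X'" "fits Y f X' m" "fits Z g X' n" "distinct X'"
    by (cases X) auto
  show ?case
    using 5(1)[OF X(2-4) mono_Skip[OF 5(5)[unfolded X(1)]] mono_Skip[OF 5(6)[unfolded X(1)]] 5(7-9)]
    by (simp add: X)
next
  case (6 f g h)
  then obtain x X' where X: "X = x # X'" "x \<notin> set X'" "fits Y f X' m" "fits Z g X' n"
    "fits Z h X' n" "distinct X'"
    by (cases X) auto
  note f = mono_Skip[OF 6(6)[unfolded X(1)]] and gh = mono_Branch[OF X(4,5,2) 6(7)[unfolded X(1)]]
  note IH = 6(1)[OF X(3,4,6) f gh(1) 6(8-10)] 6(2)[OF X(3,5,6) f gh(2) 6(8-10)]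
  show ?case using IH gh(3)[of U2] 6(10) by (auto simp: X)
next
  case (7 f h g)
  then obtain x X' where X: "X = x # X'" "x \<notin> set X'" "fits Y f X' m" "fits Z g X' n"
    "fits Y h X' m" "distinct X'"
    by (cases X) auto
  note g = mono_Skip[OF 7(7)[unfolded X(1)]] and fh = mono_Branch[OF X(3,5,2) 7(6)[unfolded X(1)]]
  note IH = 7(1)[OF X(3,4,6) fh(1) g 7(8-10)] 7(2)[OF X(5,4,6) fh(2) g 7(8-10)]
  show ?case using IH fh(3)[of U1] 7(9) by (auto simp: X)
next
  case (8 f h g k)
  then obtain x X' where X: "X = x # X'" "x \<notin> set X'" "fits Y f X' m" "fits Z g X' n"
    "fits Y h X' m" "fits Z k X' n" "distinct X'"
    by (cases X) auto
  note fh = mono_Branch[OF X(3,5,2) 8(7)[unfolded X(1)]] and gk = mono_Branch[OF X(4,6,2) 8(8)[unfolded X(1)]]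
  note IH = 8(1)[OF X(3,4,7) fh(1) gk(1) 8(9-11)] 8(2)[OF X(3,6,7) fh(1) gk(2) 8(9-11)]
    8(3)[OF X(5,4,7) fh(2) gk(1) 8(9-11)]
  note m = table_val_tmax[OF fits_tconv[OF X(3,6)] fits_tconv[OF X(5,4)]]
  \<comment> \<open>The last case covers both \<open>x \<in> U2\<close> and \<open>x\<close> in
    neither part; in the latter \<open>x\<close> is given to the second table.\<close>
  consider "x \<notin> U" "x \<notin> U1" "x \<notin> U2" | "x \<in> U" "x \<in> U1" "x \<notin> U2" | "x \<in> U" "x \<notin> U1"
    using 8(9-11) by blast
  then show ?case
  proof cases
    case 1
    then show ?thesis using IH(1) by (simp add: X)
  next
    case 2
    then show ?thesis using IH(3) by (simp add: X m le_max_iff_disj)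
  next
    case 3
    then show ?thesis using IH(2) gk(3)[of U2] by (auto simp: X m le_max_iff_disj)
  qed
qed auto

text \<open>Following the branches taken by the convolution yields an explicit split that attains
  its value.\<close>

lemma table_val_tconv_le:
  "fits Y f X m \<Longrightarrow> fits Z g X n \<Longrightarrow> distinct X \<Longrightarrow>
   \<exists>U1 U2. U1 \<inter> U2 = {} \<and> U1 \<subseteq> U \<and> U2 \<subseteq> U \<and>
     table_val (tconv f g) X U = table_val f X U1 + table_val g X U2"
proof (induction f g arbitrary: X m n rule: tconv.induct)
  case (1 g)
  then show ?case by (intro exI[of _ "{}"] exI[of _ U]) auto
next
  case (2 f g)
  then have X: "X = []" "fits Y f X (m - 1)" by auto
  obtain U1 U2 where "U1 \<inter> U2 = {}" "U1 \<subseteq> U" "U2 \<subseteq> U"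
      "table_val (tconv f g) X U = table_val f X U1 + table_val g X U2"
    using 2(1)[OF X(2) 2(3,4)] by blast
  then show ?case by (intro exI[of _ U1] exI[of _ U2]) simp
next
  case (3 f)
  then show ?case by (intro exI[of _ "{}"] exI[of _ U]) auto
next
  case (4 f h)
  then show ?case by (intro exI[of _ "{}"] exI[of _ U]) auto
next
  case (5 f g)
  then show ?case by (cases X) auto
next
  case (6 f g h)
  then obtain x X' where X: "X = x # X'" "x \<notin> set X'" "fits Y f X' m" "fits Z g X' n"
    "fits Z h X' n" "distinct X'"
    by (cases X) auto
  show ?case
  proof (cases "x \<in> U")
    case True
    obtain U1 U2 where U: "U1 \<inter> U2 = {}" "U1 \<subseteq> U" "U2 \<subseteq> U"
      "table_val (tconv f h) X' U = table_val f X' U1 + table_val h X' U2"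
      using 6(2)[OF X(3,5,6)] by blast
    \<comment> \<open>The recursive split says nothing useful about \<open>x\<close>, so
      \<open>x\<close> is moved to the side whose right subtable is read. The subtables do not
      notice, since \<open>x \<notin> set X'\<close>.\<close>
    have "table_val f X' (U1 - {x}) = table_val f X' U1"
      "table_val h X' (insert x U2) = table_val h X' U2"
      using X(2) by (intro table_val_cong[OF X(3)] table_val_cong[OF X(5)]; auto)+
    then show ?thesis using U True
      by (intro exI[of _ "U1 - {x}"] exI[of _ "insert x U2"]) (auto simp: X)
  next
    case False
    obtain U1 U2 where U: "U1 \<inter> U2 = {}" "U1 \<subseteq> U" "U2 \<subseteq> U"
      "table_val (tconv f g) X' U = table_val f X' U1 + table_val g X' U2"
      using 6(1)[OF X(3,4,6)] by blast
    then show ?thesis using False by (intro exI[of _ U1] exI[of _ U2]) (auto simp: X)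
  qed
next
  case (7 f h g)
  then obtain x X' where X: "X = x # X'" "x \<notin> set X'" "fits Y f X' m" "fits Z g X' n"
    "fits Y h X' m" "distinct X'"
    by (cases X) auto
  show ?case
  proof (cases "x \<in> U")
    case True
    obtain U1 U2 where U: "U1 \<inter> U2 = {}" "U1 \<subseteq> U" "U2 \<subseteq> U"
      "table_val (tconv h g) X' U = table_val h X' U1 + table_val g X' U2"
      using 7(2)[OF X(5,4,6)] by blast
    have "table_val g X' (U2 - {x}) = table_val g X' U2"
      "table_val h X' (insert x U1) = table_val h X' U1"
      using X(2) by (intro table_val_cong[OF X(4)] table_val_cong[OF X(5)]; auto)+
    then show ?thesis using U True
      by (intro exI[of _ "insert x U1"] exI[of _ "U2 - {x}"]) (auto simp: X)
  next
    case False
    obtain U1 U2 where U: "U1 \<inter> U2 = {}" "U1 \<subseteq> U" "U2 \<subseteq> U"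
      "table_val (tconv f g) X' U = table_val f X' U1 + table_val g X' U2"
      using 7(1)[OF X(3,4,6)] by blast
    then show ?thesis using False by (intro exI[of _ U1] exI[of _ U2]) (auto simp: X)
  qed
next
  case (8 f h g k)
  then obtain x X' where X: "X = x # X'" "x \<notin> set X'" "fits Y f X' m" "fits Z g X' n"
    "fits Y h X' m" "fits Z k X' n" "distinct X'"
    by (cases X) auto
  note m = table_val_tmax[OF fits_tconv[OF X(3,6)] fits_tconv[OF X(5,4)]]
  consider "x \<notin> U" | "x \<in> U" "table_val (tmax (tconv f k) (tconv h g)) X' U = table_val (tconv f k) X' U"
    | "x \<in> U" "table_val (tmax (tconv f k) (tconv h g)) X' U = table_val (tconv h g) X' U"
    unfolding m by linarith
  then show ?case
  proof cases
    case 1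
    obtain U1 U2 where U: "U1 \<inter> U2 = {}" "U1 \<subseteq> U" "U2 \<subseteq> U"
      "table_val (tconv f g) X' U = table_val f X' U1 + table_val g X' U2"
      using 8(1)[OF X(3,4,7)] by blast
    then show ?thesis using 1 by (intro exI[of _ U1] exI[of _ U2]) (auto simp: X)
  next
    case 2
    obtain U1 U2 where U: "U1 \<inter> U2 = {}" "U1 \<subseteq> U" "U2 \<subseteq> U"
      "table_val (tconv f k) X' U = table_val f X' U1 + table_val k X' U2"
      using 8(2)[OF X(3,6,7)] by blast
    have "table_val f X' (U1 - {x}) = table_val f X' U1"
      "table_val k X' (insert x U2) = table_val k X' U2"
      using X(2) by (intro table_val_cong[OF X(3)] table_val_cong[OF X(6)]; auto)+
    then show ?thesis using U 2
      by (intro exI[of _ "U1 - {x}"] exI[of _ "insert x U2"]) (auto simp: X)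
  next
    case 3
    obtain U1 U2 where U: "U1 \<inter> U2 = {}" "U1 \<subseteq> U" "U2 \<subseteq> U"
      "table_val (tconv h g) X' U = table_val h X' U1 + table_val g X' U2"
      using 8(3)[OF X(5,4,7)] by blast
    have "table_val g X' (U2 - {x}) = table_val g X' U2"
      "table_val h X' (insert x U1) = table_val h X' U1"
      using X(2) by (intro table_val_cong[OF X(4)] table_val_cong[OF X(5)]; auto)+
    then show ?thesis using U 3
      by (intro exI[of _ "insert x U1"] exI[of _ "U2 - {x}"]) (auto simp: X)
  qed
qed auto

section \<open>Packings and the meaning of a table\<close>

definition packing :: "('e \<Rightarrow> 'x set) \<Rightarrow> 'e set \<Rightarrow> bool" where
  "packing S M \<longleftrightarrow> (\<forall>e\<in>M. \<forall>e'\<in>M. e \<noteq> e' \<longrightarrow> S e \<inter> S e' = {})"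

lemma packing_subset: "packing S M \<Longrightarrow> N \<subseteq> M \<Longrightarrow> packing S N"
  by (auto simp: packing_def)

text \<open>The table \<open>f\<close> maps \<open>U\<close> to the largest size of a packing from \<open>A\<close> that, among the visible
  variables \<open>Y\<close>, only uses those in \<open>U\<close>.\<close>

definition solves :: "('e \<Rightarrow> 'x set) \<Rightarrow> 'x set \<Rightarrow> 'e set \<Rightarrow> table \<Rightarrow> 'x list \<Rightarrow> bool" where
  "solves S Y A f X \<longleftrightarrow> (\<forall>U.
     (\<exists>M\<subseteq>A. packing S M \<and> \<Union>(S ` M) \<inter> Y \<subseteq> U \<and> card M = table_val f X U) \<and>
     (\<forall>M\<subseteq>A. packing S M \<longrightarrow> \<Union>(S ` M) \<inter> Y \<subseteq> U \<longrightarrow> card M \<le> table_val f X U))"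

lemma solves_exists:
  assumes "solves S Y A f X"
  obtains M where "M \<subseteq> A" "packing S M" "\<Union>(S ` M) \<inter> Y \<subseteq> U" "card M = table_val f X U"
  using assms[unfolded solves_def, THEN spec[of _ U], THEN conjunct1] by (elim exE conjE) (rule that)

lemma solves_le:
  "solves S Y A f X \<Longrightarrow> M \<subseteq> A \<Longrightarrow> packing S M \<Longrightarrow> \<Union>(S ` M) \<inter> Y \<subseteq> U \<Longrightarrow> card M \<le> table_val f X U"
  unfolding solves_def by simp

text \<open>An optimal packing for \<open>U\<close> stays admissible for every larger set.\<close>

lemma solves_mono:
  fixes S :: "'e \<Rightarrow> 'x set"
  assumes f: "solves S Y A f X"
  shows "mono (table_val f X)"
proof (rule monoI)
  fix U U' :: "'x set"
  assume U: "U \<subseteq> U'"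
  obtain M where M: "M \<subseteq> A" "packing S M" "\<Union>(S ` M) \<inter> Y \<subseteq> U" "card M = table_val f X U"
    by (rule solves_exists[OF f])
  from solves_le[OF f M(1,2) order.trans[OF M(3) U]] M(4)
  show "table_val f X U \<le> table_val f X U'" by simp
qed

lemma solves_Zero: "solves S Y {} Zero X"
  by (auto simp: solves_def packing_def)

text \<open>The conditions \<open>sub\<close> say that \<open>Y\<close> separates: a pair used by
  edges of both \<open>A\<close> and \<open>A'\<close> lies in \<open>Y\<close>, then in
  \<open>Z\<close>, and so is visible in both tables, where disjointness of \<open>U1\<close> and
  \<open>U2\<close> forbids it. By \<open>ne\<close>, an edge chosen on both sides would be such a
  conflict with itself, so sizes add up.\<close>

lemma solves_tconv:
  assumes fits: "fits Y f X m" "fits Z g X n" "distinct X"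
    and f: "solves S Y A f X" and g: "solves S Z A' g X"
    and fin: "finite A" "finite A'"
    and sub: "Z \<subseteq> Y" "\<Union>(S ` A') \<inter> Y \<subseteq> Z" "\<Union>(S ` A) \<inter> \<Union>(S ` A') \<subseteq> Y"
    and ne: "\<forall>e\<in>A'. S e \<noteq> {}"
  shows "solves S Y (A \<union> A') (tconv f g) X"
  unfolding solves_def
proof (intro allI conjI impI)
  fix U
  obtain U1 U2 where U: "U1 \<inter> U2 = {}" "U1 \<subseteq> U" "U2 \<subseteq> U"
      "table_val (tconv f g) X U = table_val f X U1 + table_val g X U2"
    using table_val_tconv_le[OF fits, of U] by blast
  obtain M1 where M1: "M1 \<subseteq> A" "packing S M1" "\<Union>(S ` M1) \<inter> Y \<subseteq> U1" "card M1 = table_val f X U1"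
    by (rule solves_exists[OF f])
  obtain M2 where M2: "M2 \<subseteq> A'" "packing S M2" "\<Union>(S ` M2) \<inter> Z \<subseteq> U2" "card M2 = table_val g X U2"
    by (rule solves_exists[OF g])
  have dis: "S e \<inter> S e' = {}" if "e \<in> M1" "e' \<in> M2" for e e'
  proof (rule ccontr)
    assume "S e \<inter> S e' \<noteq> {}"
    then obtain z where z: "z \<in> S e" "z \<in> S e'" by blast
    then have "z \<in> Y" using sub(3) that M1(1) M2(1) by blast
    moreover from this have "z \<in> Z" using sub(2) z that M2(1) by blast
    ultimately have "z \<in> U1" "z \<in> U2" using M1(3) M2(3) z that by blast+
    then show False using U(1) by blast
  qed
  have "M1 \<inter> M2 = {}" using dis ne M2(1) by fastforce
  then have "card (M1 \<union> M2) = card M1 + card M2"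
    using M1(1) M2(1) fin by (intro card_Un_disjoint) (auto intro: finite_subset)
  moreover have "packing S (M1 \<union> M2)"
    using M1(2) M2(2) dis unfolding packing_def by blast
  moreover have "\<Union>(S ` (M1 \<union> M2)) \<inter> Y \<subseteq> U"
  proof
    fix z assume "z \<in> \<Union>(S ` (M1 \<union> M2)) \<inter> Y"
    then obtain e where e: "e \<in> M1 \<union> M2" "z \<in> S e" "z \<in> Y" by blast
    show "z \<in> U"
    proof (cases "e \<in> M1")
      case True
      then have "z \<in> U1" using M1(3) e by blast
      then show ?thesis using U(2) by blast
    next
      case False
      then have "e \<in> M2" "e \<in> A'" using e(1) M2(1) by blast+
      then have "z \<in> Z" using sub(2) e by blast
      then have "z \<in> U2" using M2(3) \<open>e \<in> M2\<close> e(2) by blast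
      then show ?thesis using U(3) by blast
    qed
  qed
  ultimately show "\<exists>M\<subseteq>A \<union> A'. packing S M \<and> \<Union>(S ` M) \<inter> Y \<subseteq> U \<and> card M = table_val (tconv f g) X U"
    using U(4) M1(1,4) M2(1,4) by (intro exI[of _ "M1 \<union> M2"]) auto
next
  fix U M assume M: "M \<subseteq> A \<union> A'" "packing S M" "\<Union>(S ` M) \<inter> Y \<subseteq> U"
  define M1 where "M1 = M \<inter> A"
  \<comment> \<open>Edges belonging to both \<open>A\<close> and \<open>A'\<close> are counted on
    the first side only; the rest lies in \<open>A'\<close>.\<close>
  define M2 where "M2 = M - A"
  let ?U1 = "\<Union>(S ` M1) \<inter> Y" and ?U2 = "\<Union>(S ` M2) \<inter> Y"
  have "card M1 \<le> table_val f X ?U1"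
    by (rule solves_le[OF f]) (use M packing_subset[OF M(2)] in \<open>auto simp: M1_def\<close>)
  moreover have "card M2 \<le> table_val g X ?U2"
    by (rule solves_le[OF g]) (use M sub(1) packing_subset[OF M(2)] in \<open>auto simp: M2_def\<close>)
  moreover have "card M = card M1 + card M2"
    using M(1) fin unfolding M1_def M2_def
    by (metis Int_Diff_Un Int_Diff_disjoint card_Un_disjoint finite_Int finite_Un finite_subset finite_Diff)
  moreover have "?U1 \<inter> ?U2 = {}"
  proof -
    have "S e \<inter> S e' = {}" if "e \<in> M1" "e' \<in> M2" for e e'
    proof -
      have "e \<in> M" "e' \<in> M" "e \<noteq> e'" using that by (auto simp: M1_def M2_def)
      then show ?thesis using M(2) by (simp add: packing_def)
    qed
    then show ?thesis by blast
  qed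
  moreover have "?U1 \<subseteq> U" "?U2 \<subseteq> U" using M(3) by (auto simp: M1_def M2_def)
  ultimately show "card M \<le> table_val (tconv f g) X U"
    using table_val_tconv_ge[OF fits solves_mono[OF f] solves_mono[OF g], of ?U1 ?U2 U] by linarith
qed

lemma table_val_edge_table:
  "table_val (edge_table e X) X U = (if slots e \<inter> set X \<subseteq> U then 1 else 0)"
  by (induction X) auto

lemma solves_edge_table:
  assumes "slots e \<subseteq> set X"
  shows "solves slots (slots e) {e} (edge_table e X) X"
proof -
  have val: "table_val (edge_table e X) X U = (if slots e \<subseteq> U then 1 else 0)" for U
    using assms by (simp add: table_val_edge_table Int_absorb2)
  show ?thesis
    unfolding solves_def val
  proof (intro allI conjI impI)
    fix U
    show "\<exists>M\<subseteq>{e}. packing slots M \<and> \<Union>(slots ` M) \<inter> slots e \<subseteq> U \<and> card M = (if slots e \<subseteq> U then 1 else 0)"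
      by (intro exI[of _ "if slots e \<subseteq> U then {e} else {}"]) (simp add: packing_def)
  next
    fix U M
    assume M: "M \<subseteq> {e}" "\<Union>(slots ` M) \<inter> slots e \<subseteq> U"
    from M(1) have "M = {} \<or> M = {e}" by (simp add: subset_singleton_iff)
    then show "card M \<le> (if slots e \<subseteq> U then 1 else 0)" using M(2) by (elim disjE) simp_all
  qed
qed

lemma table_val_res:
  "fits Y f X n \<Longrightarrow> table_val (res b f X) X U = table_val f X (U \<union> - bag_vars b)"
proof (induction f arbitrary: X n)
  case (Plus1 f)
  then have "X = []" "fits Y f [] (n - 1)" by auto
  then show ?case using table_val_cong[of Y f "[]" "n - 1" U "U \<union> - bag_vars b"] by simp
next
  case (Skip f)
  then show ?case by (cases X) auto
next
  case (Branch f g)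
  then show ?case by (cases X) auto
qed auto

lemma solves_res:
  assumes "fits Y f X n" "solves S Y A f X"
  shows "solves S (bag_vars b \<inter> Y) A (res b f X) X"
proof -
  \<comment> \<open>Hiding pairs in the table amounts to adding them to the available set.\<close>
  have "T \<inter> (bag_vars b \<inter> Y) \<subseteq> U \<longleftrightarrow> T \<inter> Y \<subseteq> U \<union> - bag_vars b" for T U by blast
  note eq = this[of "\<Union>(S ` M)" for M]
  show ?thesis
    unfolding solves_def table_val_res[OF assms(1)] eq
    by (rule allI) (rule assms(2)[unfolded solves_def, THEN spec])
qed

lemma slots_ne: "snd e \<noteq> [] \<Longrightarrow> slots e \<noteq> {}"
  by (cases e rule: ends.cases) (simp add: slots_def)

lemma slots_bag: "ends e \<subseteq> set b \<Longrightarrow> slots e \<subseteq> bag_vars b"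
  by (auto simp: slots_def bag_vars_def)

lemma solves_tconv_edge:
  assumes "fits Y f X n" "distinct X" "solves slots Y A f X" "finite A"
    and "slots e \<subseteq> set X" "slots e \<subseteq> Y" "snd e \<noteq> []"
  shows "solves slots Y (insert e A) (tconv f (edge_table e X)) X"
  using solves_tconv[OF assms(1) fits_edge_table assms(2,3) solves_edge_table[OF assms(5)] assms(4)]
    assms(6) slots_ne[OF assms(7)] by auto

lemma solves_add_edges:
  assumes "distinct X"
  shows "fits (bag_vars b) f X n \<Longrightarrow> solves slots (bag_vars b) A f X \<Longrightarrow> finite A \<Longrightarrow>
    \<forall>e\<in>set es. slots e \<subseteq> set X \<and> snd e \<noteq> [] \<Longrightarrow>
    solves slots (bag_vars b) (A \<union> {e \<in> set es. ends e \<subseteq> set b}) (add_edges b es X f) X"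
proof (induction es arbitrary: f n A)
  case (Cons e es)
  show ?case
  proof (cases "ends e \<subseteq> set b")
    case True
    have s: "slots e \<inter> set X \<subseteq> bag_vars b" using slots_bag[OF True] by blast
    have "solves slots (bag_vars b) (insert e A) (tconv f (edge_table e X)) X"
      using Cons.prems slots_bag[OF True] by (intro solves_tconv_edge[OF _ assms]) auto
    from Cons.IH[OF tconv_edge_table_fits[OF Cons.prems(1) s] this] Cons.prems
    have "solves slots (bag_vars b) (insert e A \<union> {e \<in> set es. ends e \<subseteq> set b})
        (add_edges b (e # es) X f) X" using True by simp
    moreover have "insert e A \<union> {e \<in> set es. ends e \<subseteq> set b} = A \<union> {e' \<in> set (e # es). ends e' \<subseteq> set b}"
      using True by auto
    ultimately show ?thesis by simp
  next
    case False
    then have "{e' \<in> set (e # es). ends e' \<subseteq> set b} = {e \<in> set es. ends e \<subseteq> set b}" by auto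
    then show ?thesis using Cons.IH[OF Cons.prems(1-3)] Cons.prems(4) False by simp
  qed
qed simp

section \<open>Separation by bags and correctness of the traversal\<close>

definition verts :: "nat list rtree \<Rightarrow> nat set" where
  "verts t = \<Union>(set ` set_rtree t)"

definition tree_edges :: "tedge list \<Rightarrow> nat list rtree \<Rightarrow> tedge set" where
  "tree_edges es t = {e \<in> set es. \<exists>l\<in>set_rtree t. ends e \<subseteq> set l}"

text \<open>The local form of the connectivity axiom that the joins need: subtrees of different
  children meet only inside the bag \<open>b\<close>, and a subtree meets \<open>b\<close> only
  inside its own root bag.\<close>

definition attached :: "nat list \<Rightarrow> nat list rtree list \<Rightarrow> bool" where
  "attached b ts \<longleftrightarrow> sorted_wrt (\<lambda>t t'. verts t \<inter> verts t' \<subseteq> set b) ts \<and>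
     (\<forall>t\<in>set ts. verts t \<inter> set b \<subseteq> set (label t))"

fun coherent :: "nat list rtree \<Rightarrow> bool" where
  "coherent (RNode l cs) \<longleftrightarrow> attached l cs \<and> (\<forall>c\<in>set cs. coherent c)"

lemma verts_Node: "verts (RNode l cs) = set l \<union> \<Union>(verts ` set cs)"
  by (auto simp: verts_def)

lemma tree_edges_Node:
  "tree_edges es (RNode l cs) = {e \<in> set es. ends e \<subseteq> set l} \<union> \<Union>(tree_edges es ` set cs)"
  by (auto simp: tree_edges_def)

lemma ends_tree_edges: "e \<in> tree_edges es t \<Longrightarrow> ends e \<subseteq> verts t"
  by (auto simp: tree_edges_def verts_def)

lemma slots_fst: "z \<in> slots e \<Longrightarrow> fst z \<in> ends e"
  by (auto simp: slots_def)

text \<open>\<open>W\<close> contains the vertices touched by the edges accumulated so far. These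
  edges may come from anywhere, in particular from outside the current list of children after a
  contained bag was skipped; the invariant is that the subtrees still to come meet \<open>W\<close>
  only in \<open>b\<close>.\<close>

lemma solves_absorb:
  "distinct X \<Longrightarrow> \<forall>e\<in>set es. slots e \<subseteq> set X \<and> snd e \<noteq> [] \<Longrightarrow>
   fits (bag_vars b) f X n \<Longrightarrow> solves slots (bag_vars b) A f X \<Longrightarrow> finite A \<Longrightarrow>
   {e \<in> set es. ends e \<subseteq> set b} \<subseteq> A \<Longrightarrow> \<Union>(ends ` A) \<subseteq> W \<Longrightarrow> attached b ts \<Longrightarrow>
   \<forall>t\<in>set ts. coherent t \<and> W \<inter> verts t \<subseteq> set b \<Longrightarrow>
   solves slots (bag_vars b) (A \<union> \<Union>(tree_edges es ` set ts)) (absorb X es b f ts) X"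
proof (induction X es b f ts arbitrary: n A W rule: absorb.induct)
  case (1 X es b f)
  then show ?case by simp
next
  case (2 X es b f l cs ts)
  note X = 2(4) and es = 2(5) and fits = 2(6) and sol = 2(7) and fin = 2(8) and A = 2(9) and W = 2(10)
  let ?t = "RNode l cs"
  let ?a = "add_edges l es X Zero"
  let ?g = "absorb X es l ?a cs"
  let ?f = "if set l \<subseteq> set b then absorb X es b f cs else tconv f (res b ?g X)"
  let ?El = "{e \<in> set es. ends e \<subseteq> set l}"
  have att: "\<forall>t\<in>set ts. verts ?t \<inter> verts t \<subseteq> set b" "attached b ts" "verts ?t \<inter> set b \<subseteq> set l"
    using 2(11) by (auto simp: attached_def)
  have coh: "attached l cs" "\<forall>c\<in>set cs. coherent c" "W \<inter> verts ?t \<subseteq> set b"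
    "\<forall>t\<in>set ts. coherent t \<and> W \<inter> verts t \<subseteq> set b"
    using 2(12) by auto
  have fit': "fits (bag_vars b) ?f X (n + Suc (sum_list (map nodes cs)) * length es)"
    using absorb_fits[OF fits, of es "[?t]"] by simp
  have sol': "solves slots (bag_vars b) (A \<union> tree_edges es ?t) ?f X"
  proof (cases "set l \<subseteq> set b")
    case True
    have vc: "verts c \<subseteq> verts ?t" if "c \<in> set cs" for c using that by (auto simp: verts_Node)
    have "attached b cs"
      unfolding attached_def
    proof (intro conjI ballI)
      show "sorted_wrt (\<lambda>t t'. verts t \<inter> verts t' \<subseteq> set b) cs"
        by (rule sorted_wrt_mono_rel[of cs "\<lambda>t t'. verts t \<inter> verts t' \<subseteq> set l"])
          (use True coh(1) in \<open>auto simp: attached_def\<close>)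
    next
      fix c assume c: "c \<in> set cs"
      \<comment> \<open>A vertex of \<open>c\<close> in \<open>b\<close> is a vertex of the whole
        subtree in \<open>b\<close>, hence in \<open>l\<close>; this is what lets the grandchildren
        be treated as children of \<open>b\<close>.\<close>
      have "verts c \<inter> set b \<subseteq> verts c \<inter> set l" using vc[OF c] att(3) by blast
      also have "\<dots> \<subseteq> set (label c)" using coh(1) c by (simp add: attached_def)
      finally show "verts c \<inter> set b \<subseteq> set (label c)" .
    qed
    moreover have "\<forall>c\<in>set cs. coherent c \<and> W \<inter> verts c \<subseteq> set b"
      using coh(2,3) vc by blast
    ultimately have "solves slots (bag_vars b) (A \<union> \<Union>(tree_edges es ` set cs)) (absorb X es b f cs) X"
      by (rule 2(1)[OF True X es fits sol fin A W])
    moreover have "A \<union> tree_edges es ?t = A \<union> \<Union>(tree_edges es ` set cs)"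
    proof -
      \<comment> \<open>Edges inside the skipped bag \<open>l\<close> are also inside
        \<open>b\<close> and were added there.\<close>
      have "?El \<subseteq> A" using True A by blast
      then have "A \<union> (?El \<union> T) = A \<union> T" for T by blast
      then show ?thesis by (simp only: tree_edges_Node)
    qed
    ultimately show ?thesis using True by simp
  next
    case False
    have f0: "fits (bag_vars l) Zero X 0" by simp
    have fa: "fits (bag_vars l) ?a X (length es)" using add_edges_fits[OF f0, of es] by simp
    have sa: "solves slots (bag_vars l) ?El ?a X"
      using solves_add_edges[OF X f0 solves_Zero finite.emptyI es] by simp
    \<comment> \<open>The child table starts afresh with the edges inside \<open>l\<close>, so
      \<open>set l\<close> is its \<open>W\<close>.\<close>
    have "\<forall>c\<in>set cs. coherent c \<and> set l \<inter> verts c \<subseteq> set l" using coh(2) by blast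
    from 2(2)[OF False X es fa sa _ order.refl _ coh(1) this]
    have sg: "solves slots (bag_vars l) (tree_edges es ?t) ?g X"
      unfolding tree_edges_Node by auto
    have fg: "fits (bag_vars l) ?g X (length es + sum_list (map nodes cs) * length es)"
      by (rule absorb_fits[OF fa])
    have fin': "finite (tree_edges es ?t)" by (simp add: tree_edges_def)
    have "solves slots (bag_vars b) (A \<union> tree_edges es ?t) (tconv f (res b ?g X)) X"
    proof (rule solves_tconv[OF fits fits_res[OF fg] X sol solves_res[OF fg sg] fin fin'])
      show "bag_vars b \<inter> bag_vars l \<subseteq> bag_vars b" by blast
      show "\<Union>(slots ` tree_edges es ?t) \<inter> bag_vars b \<subseteq> bag_vars b \<inter> bag_vars l"
      proof
        fix z assume "z \<in> \<Union>(slots ` tree_edges es ?t) \<inter> bag_vars b"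
        then obtain e where e: "e \<in> tree_edges es ?t" "z \<in> slots e" "z \<in> bag_vars b" by blast
        have "fst z \<in> verts ?t" using ends_tree_edges[OF e(1)] slots_fst[OF e(2)] by blast
        moreover have "fst z \<in> set b" using e(3) by (auto simp: bag_vars_def)
        ultimately have "fst z \<in> set l" using att(3) by blast
        then show "z \<in> bag_vars b \<inter> bag_vars l" using e(3) by (cases z) (simp add: bag_vars_def)
      qed
      show "\<Union>(slots ` A) \<inter> \<Union>(slots ` tree_edges es ?t) \<subseteq> bag_vars b"
      proof
        fix z assume "z \<in> \<Union>(slots ` A) \<inter> \<Union>(slots ` tree_edges es ?t)"
        then obtain e e' where e: "e \<in> tree_edges es ?t" "z \<in> slots e" "e' \<in> A" "z \<in> slots e'" by blast
        have "fst z \<in> verts ?t" using ends_tree_edges[OF e(1)] slots_fst[OF e(2)] by blast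
        moreover have "fst z \<in> W" using W slots_fst[OF e(4)] e(3) by blast
        ultimately have "fst z \<in> set b" using coh(3) by blast
        then show "z \<in> bag_vars b" by (cases z) (simp add: bag_vars_def)
      qed
      show "\<forall>e\<in>tree_edges es ?t. slots e \<noteq> {}"
        using es slots_ne by (auto simp: tree_edges_def)
    qed
    then show ?thesis using False by simp
  qed
  have W': "\<Union>(ends ` (A \<union> tree_edges es ?t)) \<subseteq> W \<union> verts ?t"
    using W ends_tree_edges[of _ es ?t] by blast
  have "\<forall>t\<in>set ts. coherent t \<and> (W \<union> verts ?t) \<inter> verts t \<subseteq> set b"
    using coh(4) att(1) by blast
  moreover have "finite (A \<union> tree_edges es ?t)" using fin by (simp add: tree_edges_def)
  moreover have "{e \<in> set es. ends e \<subseteq> set b} \<subseteq> A \<union> tree_edges es ?t" using A by blast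
  ultimately have "solves slots (bag_vars b) (A \<union> tree_edges es ?t \<union> \<Union>(tree_edges es ` set ts))
      (absorb X es b ?f ts) X"
    using 2(3)[OF X es fit' sol' _ _ W' att(2)] by blast
  moreover have "A \<union> \<Union>(tree_edges es ` set (?t # ts)) = A \<union> tree_edges es ?t \<union> \<Union>(tree_edges es ` set ts)"
    by auto
  ultimately show ?case by simp
qed

section \<open>Rooted tree decompositions\<close>

lemma subtree_at_append:
  "subtree_at t (p @ q) = Option.bind (subtree_at t p) (\<lambda>s. subtree_at s q)"
proof (induction p arbitrary: t)
  case (Cons i p)
  then show ?case by (cases t) auto
qed simp

lemma subtree_at_map_rtree: "subtree_at (map_rtree f t) p = map_option (map_rtree f) (subtree_at t p)"
proof (induction p arbitrary: t)
  case (Cons i p)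
  then show ?case by (cases t) auto
qed simp

lemma positions_map_rtree: "positions (map_rtree f t) = positions t"
  by (simp add: positions_def subtree_at_map_rtree)

lemma label_at_map_rtree: "p \<in> positions t \<Longrightarrow> label_at (map_rtree f t) p = f (label_at t p)"
  by (auto simp: positions_def label_at_def subtree_at_map_rtree rtree.map_sel)

lemma set_rtree_label_at: "set_rtree t = label_at t ` positions t"
proof (induction t)
  case (RNode a ts)
  have "label_at (RNode a ts) ` positions (RNode a ts) =
      insert a (\<Union>i<length ts. label_at (ts ! i) ` positions (ts ! i))"
    by (simp add: positions_Node image_UN image_image label_at_def cong: SUP_cong_simp)
  also have "\<dots> = insert a (\<Union>i<length ts. set_rtree (ts ! i))" using RNode by simp
  also have "\<dots> = set_rtree (RNode a ts)"
    by (simp add: set_conv_nth) blast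
  finally show ?case by simp
qed

text \<open>A path leaving the subtree at \<open>r\<close> uses the edge between \<open>r\<close> and its parent.\<close>

lemma position_path_exit:
  assumes "(p, q) \<in> {(a, b). a \<in> S \<and> b \<in> S \<and> {a, b} \<in> position_edges t}\<^sup>*"
    and "\<exists>s. p = r @ s" "\<nexists>s. q = r @ s"
  shows "r \<in> S \<and> butlast r \<in> S"
  using assms
proof (induction rule: converse_rtrancl_induct)
  case (step a b)
  show ?case
  proof (cases "\<exists>s. b = r @ s")
    case True
    then show ?thesis using step by blast
  next
    case False
    obtain s where s: "a = r @ s" using step.prems by blast
    obtain p i where "{a, b} = {p, p @ [i]}" using step.hyps by (auto simp: position_edges_def)
    then have "a = p @ [i]" "b = p" using False s by (auto simp: doubleton_eq_iff)
    moreover have "s = []"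
    proof (rule ccontr)
      assume "s \<noteq> []"
      then have "b = r @ butlast s" using s calculation by (metis butlast_append butlast_snoc)
      then show False using False by blast
    qed
    ultimately have "a = r" "b = butlast r" using s by auto
    then show ?thesis using step.hyps by auto
  qed
qed simp

lemma verts_position:
  assumes "subtree_at d r = Some t" "v \<in> verts t"
  obtains q where "r @ q \<in> positions d" "v \<in> set (label_at d (r @ q))"
proof -
  obtain q where q: "q \<in> positions t" "v \<in> set (label_at t q)"
    using assms(2) by (auto simp: verts_def set_rtree_label_at)
  have "subtree_at d (r @ q) = subtree_at t q" using assms(1) by (simp add: subtree_at_append)
  then show ?thesis using q that[of q] by (simp add: positions_def label_at_def)
qed

text \<open>Both clauses of \<open>attached\<close> come from a path that leaves the subtree at
  \<open>r @ [i]\<close>. If it leads to a sibling subtree, it shows that the vertex is in the bag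
  at \<open>r\<close>; if it leads to \<open>r\<close> itself, that the vertex is in the bag at
  \<open>r @ [i]\<close>.\<close>

lemma coherent_subtree:
  assumes conn: "\<And>v. connected_on {p \<in> positions d. v \<in> set (label_at d p)} (position_edges d)"
  shows "subtree_at d r = Some t \<Longrightarrow> coherent t"
proof (induction t arbitrary: r)
  case (RNode l cs)
  have exit: "v \<in> set (label_at d r') \<and> v \<in> set (label_at d (butlast r'))"
    if "p \<in> positions d" "v \<in> set (label_at d p)" "q \<in> positions d" "v \<in> set (label_at d q)"
      "\<exists>s. p = r' @ s" "\<nexists>s. q = r' @ s" for p q v r'
    using position_path_exit[OF _ that(5,6), of "{p \<in> positions d. v \<in> set (label_at d p)}" d]
      conn[of v] that(1-4) unfolding connected_on_def by blast
  have l: "label_at d r = l" "r \<in> positions d"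
    using RNode.prems by (auto simp: label_at_def positions_def)
  have c: "subtree_at d (r @ [i]) = Some (cs ! i)" "label_at d (r @ [i]) = label (cs ! i)"
    if "i < length cs" for i
    using RNode.prems that by (auto simp: subtree_at_append label_at_def)
  have "attached l cs"
    unfolding attached_def
  proof (intro conjI ballI subsetI)
    show "sorted_wrt (\<lambda>t t'. verts t \<inter> verts t' \<subseteq> set l) cs"
      unfolding sorted_wrt_iff_nth_less
    proof (intro allI impI subsetI)
      fix i j v assume ij: "i < j" "j < length cs" and v: "v \<in> verts (cs ! i) \<inter> verts (cs ! j)"
      obtain q where q: "(r @ [i]) @ q \<in> positions d" "v \<in> set (label_at d ((r @ [i]) @ q))"
        using verts_position[OF c(1)] ij v by (metis IntD1 order.strict_trans)
      obtain q' where q': "(r @ [j]) @ q' \<in> positions d" "v \<in> set (label_at d ((r @ [j]) @ q'))"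
        using verts_position[OF c(1)] ij v by (metis IntD2)
      have "v \<in> set (label_at d (butlast (r @ [i])))"
        using exit[OF q q', of "r @ [i]"] ij by auto
      then show "v \<in> set l" by (simp add: l)
    qed
  next
    fix t v assume t: "t \<in> set cs" and v: "v \<in> verts t \<inter> set l"
    then obtain i where i: "i < length cs" "t = cs ! i" by (metis in_set_conv_nth)
    obtain q where q: "(r @ [i]) @ q \<in> positions d" "v \<in> set (label_at d ((r @ [i]) @ q))"
      using verts_position[OF c(1)[OF i(1)]] i v by blast
    have "v \<in> set (label_at d (r @ [i]))"
      using exit[OF q l(2), of "r @ [i]"] v by (auto simp: l)
    then show "v \<in> set (label t)" using c(2)[OF i(1)] i by simp
  qed
  moreover have "\<forall>t\<in>set cs. coherent t"
    using RNode.IH c(1) by (metis in_set_conv_nth)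
  ultimately show ?case by simp
qed

section \<open>Bounds\<close>

lemma length_union_le: "length (List.union xs ys) \<le> length xs + length ys"
proof (induction xs arbitrary: ys)
  case (Cons x xs)
  show ?case using Cons[of "List.insert x ys"]
    by (simp add: List.union_def List.insert_def split: if_splits)
qed (simp add: List.union_def)

lemma length_occurring_labels:
  "length (occurring_labels es acc) \<le> size (enc_list (map enc_tedge es)) + length acc"
proof (induction es arbitrary: acc)
  case (Cons e es)
  obtain u v ls where e: "e = ((u, v), ls)" by (metis prod.collapse)
  have "length (List.union ls acc) \<le> length ls + length acc"
    by (rule length_union_le)
  moreover have "length ls \<le> size (enc_nats ls)"
    using length_le_size_enc_list[of "map enc_nat ls"] by (simp add: enc_nats_def)
  ultimately show ?case using Cons[of "List.union ls acc"] by (simp add: e)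
qed simp

lemma nodes_le_size: "nodes t \<le> size (enc_rtree t)"
proof (induction t)
  case (RNode l cs)
  then have "sum_list (map nodes cs) \<le> size (enc_list (map enc_rtree cs))"
    by (induction cs) (auto simp: le_SucI add_mono)
  then show ?case by simp
qed

lemma size_label_le: "l \<in> set_rtree t \<Longrightarrow> size (enc_nats l) \<le> size (enc_rtree t)"
proof (induction t)
  case (RNode a cs)
  show ?case
  proof (cases "l = a")
    case False
    then obtain c where c: "c \<in> set cs" "l \<in> set_rtree c" using RNode.prems by auto
    have "size (enc_rtree c) < size (enc_list (map enc_rtree cs))"
      using c(1) by (intro size_enc_list_ge) simp
    then show ?thesis using RNode.IH[OF c] by simp
  qed simp
qed

lemma cnt_product:
  "cnt (B \<times> UNIV) (List.product vs ts) = length (filter (\<lambda>v. v \<in> B) vs) * length ts"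
  by (induction vs) (auto simp: filter_map comp_def)

lemma length_filter_le_card:
  assumes "distinct vs" "finite B"
  shows "length (filter (\<lambda>v. v \<in> B) vs) \<le> card B"
proof -
  have "length (filter (\<lambda>v. v \<in> B) vs) = card (set (filter (\<lambda>v. v \<in> B) vs))"
    by (rule distinct_card[symmetric]) (simp add: assms)
  also have "\<dots> \<le> card B" using assms(2) by (intro card_mono) auto
  finally show ?thesis .
qed

text \<open>If there are labels at all, the width is positive, which pays for the exponent \<open>w + 1\<close>
  coming from bags of size \<open>w + 1\<close>.\<close>

lemma pow_bound:
  fixes w k tau :: nat
  assumes "k \<le> tau" "0 < k \<Longrightarrow> 1 \<le> w" "a \<le> w" "a + c \<le> w + 1"
  shows "3 ^ (a * k) * 2 ^ (c * k) \<le> (8::nat) ^ (w * tau)"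
proof (cases "k = 0")
  case False
  then have w: "1 \<le> w" using assms(2) by simp
  have "(3::nat) ^ a * 2 ^ c \<le> 3 ^ a * 2 ^ (w - a + 1)"
    using assms(3,4) by (intro mult_le_mono2 power_increasing) auto
  also have "\<dots> = 3 ^ a * 2 ^ (w - a) * 2" by simp
  \<comment> \<open>The spare factor 2 is at most \<open>2 ^ w\<close> because \<open>w\<close> is
    positive; it completes \<open>3 ^ w\<close> to \<open>6 ^ w\<close>.\<close>
  also have "\<dots> \<le> 3 ^ a * 3 ^ (w - a) * 2 ^ w"
    using w power_increasing[of 1 w "2::nat"] by (intro mult_le_mono power_mono) auto
  also have "\<dots> = (6::nat) ^ w"
    using assms(3) by (simp flip: power_add power_mult_distrib)
  also have "\<dots> \<le> 8 ^ w" by (intro power_mono) auto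
  finally have "((3::nat) ^ a * 2 ^ c) ^ k \<le> (8 ^ w) ^ k" by (intro power_mono) auto
  also have "\<dots> = 8 ^ (w * k)" by (simp add: power_mult)
  also have "\<dots> \<le> 8 ^ (w * tau)" using assms(1) by (intro power_increasing) auto
  finally show ?thesis by (simp add: power_mult power_mult_distrib)
qed simp

lemma pow_bound2:
  fixes w k tau :: nat
  assumes "k \<le> tau" "0 < k \<Longrightarrow> 1 \<le> w" "c \<le> w + 1"
  shows "2 ^ (c * k) \<le> (8::nat) ^ (w * tau)"
  using pow_bound[OF assms(1,2), of 0 c] assms(3) by simp

text \<open>With \<open>M = N + 1\<close>, the depth \<open>H + L + 2\<close> is at most
  \<open>2 * M\<^sup>2\<close>, so a convolution costs order \<open>M ^ 4 * Q\<close>; doing one for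
  each edge gives the fifth power. The constant is \<open>1700 + 100 + 1200 + 100 + 100\<close>, the
  sum of \<open>b1\<close> to \<open>b5\<close>.\<close>

lemma node_bound_le:
  assumes "H \<le> N\<^sup>2" "L \<le> N\<^sup>2" "1 \<le> Q"
  shows "node_bound N H L Q \<le> 3200 * (N + 1) ^ 5 * Q"
proof -
  define M where "M = N + 1"
  have M: "1 \<le> M" by (simp add: M_def)
  have p: "M ^ i * Q \<le> M ^ 5 * Q" if "i \<le> 5" for i
    using M that by (intro mult_le_mono power_increasing) auto
  have p': "M ^ i \<le> M ^ 5 * Q" if "i \<le> 5" for i
    using mult_le_mono[of "M ^ i" "M ^ 5" 1 Q] M that assms(3) power_increasing[of i 5 M] by simp
  have N2: "N\<^sup>2 + 1 \<le> M\<^sup>2" by (simp add: M_def power2_eq_square)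
  have s: "(H + L + 2)\<^sup>2 \<le> (2 * M\<^sup>2)\<^sup>2" "(H + L + 1)\<^sup>2 \<le> (2 * M\<^sup>2)\<^sup>2"
    using assms N2 by (intro power_mono; linarith)+
  have s4: "(2 * M\<^sup>2)\<^sup>2 = 4 * M ^ 4" by (simp add: power_mult_distrib flip: power_mult)
  have L: "L + 1 \<le> M\<^sup>2" using assms(2) N2 by linarith
  have "(L + 1) * (100 * N + 250) \<le> M\<^sup>2 * (250 * M)"
    by (rule mult_le_mono[OF L]) (simp add: M_def)
  also have "\<dots> = 250 * M ^ 3" by (simp add: power2_eq_square power3_eq_cube)
  finally have a1: "(L + 1) * (100 * N + 250) \<le> 250 * M ^ 3" .
  have a2: "300 * (H + L + 2)\<^sup>2 * Q \<le> 1200 * (M ^ 4 * Q)"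
    using mult_le_mono1[OF s(1)[unfolded s4], of "300 * Q"] by (simp add: algebra_simps)
  have m3: "M ^ 3 \<le> M ^ 4 * Q" "M \<le> M ^ 4 * Q"
    using mult_le_mono[of "M ^ 3" "M ^ 4" 1 Q] mult_le_mono[of "M ^ 1" "M ^ 4" 1 Q] M assms(3)
      power_increasing[of 3 4 M] power_increasing[of 1 4 M] by simp_all
  have "add_bound N H L Q \<le> 1700 * (M ^ 4 * Q)"
    unfolding add_bound_def using a1 a2 m3 M_def by linarith
  then have "(N + 1) * add_bound N H L Q \<le> M * (1700 * (M ^ 4 * Q))"
    unfolding M_def by (rule mult_le_mono2)
  also have "\<dots> = 1700 * (M ^ 5 * Q)" using power_Suc[of M 4] by simp
  finally have b1: "(N + 1) * add_bound N H L Q \<le> 1700 * (M ^ 5 * Q)" .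
  have "(L + 1) * Q * (100 * N + 100) \<le> M\<^sup>2 * Q * (100 * M)"
    by (intro mult_le_mono L) (auto simp: M_def)
  also have "\<dots> = 100 * (M ^ 3 * Q)" by (simp add: power2_eq_square power3_eq_cube)
  also have "\<dots> \<le> 100 * (M ^ 5 * Q)" using p[of 3] by simp
  finally have b2: "(L + 1) * Q * (100 * N + 100) \<le> 100 * (M ^ 5 * Q)" .
  have "300 * (H + L + 1)\<^sup>2 * Q \<le> 1200 * (M ^ 4 * Q)"
    using mult_le_mono1[OF s(2)[unfolded s4], of "300 * Q"] by (simp add: algebra_simps)
  then have b3: "300 * (H + L + 1)\<^sup>2 * Q \<le> 1200 * (M ^ 5 * Q)" using p[of 4] by linarith
  have "(N + 1) * (100 * N + 60) \<le> M * (100 * M)"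
    by (intro mult_le_mono) (auto simp: M_def)
  also have "\<dots> = 100 * M\<^sup>2" by (simp add: power2_eq_square)
  finally have b4: "(N + 1) * (100 * N + 60) \<le> 100 * (M ^ 5 * Q)" using p'[of 2] by linarith
  have b5: "1 \<le> M ^ 5 * Q" using p'[of 0] by simp
  have "node_bound N H L Q \<le> 3200 * (M ^ 5 * Q)"
    unfolding node_bound_def using b1 b2 b3 b4 b5 by linarith
  then show ?thesis by (simp add: M_def mult.assoc)
qed

section \<open>From packings to temporal matchings\<close>

lemma packing_slots:
  "packing slots M \<longleftrightarrow> (\<forall>e\<in>M. \<forall>e'\<in>M. e \<noteq> e' \<longrightarrow> ends e \<inter> ends e' = {} \<or> set (snd e) \<inter> set (snd e') = {})"
  unfolding packing_def slots_def by (simp add: Times_Int_Times Times_empty)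

text \<open>As no edge is listed twice, \<open>ends\<close> is injective on the list, so packings of
  listed edges and temporal matchings correspond with equal sizes.\<close>

lemma max_temporal_matching_eq:
  assumes inj: "distinct (map ends es)" and E: "ends ` set es = E"
    and lam: "\<forall>e\<in>set es. set (snd e) = lam (ends e)"
    and sol: "solves slots {} (set es) f X"
  shows "max_temporal_matching E lam = table_val f X {}"
proof -
  have inj: "inj_on ends (set es)" using inj by (simp add: distinct_map)
  have match: "temporal_matching E lam (ends ` M) \<longleftrightarrow> packing slots M" if "M \<subseteq> set es" for M
  proof -
    have "ends e = ends e' \<longleftrightarrow> e = e'" if "e \<in> M" "e' \<in> M" for e e'
      using inj_on_eq_iff[OF inj] that \<open>M \<subseteq> set es\<close> by blast
    moreover have "lam (ends e) = set (snd e)" if "e \<in> M" for e using lam that \<open>M \<subseteq> set es\<close> by auto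
    moreover have "ends ` M \<subseteq> E" using E that by blast
    ultimately show ?thesis by (simp add: temporal_matching_def packing_slots)
  qed
  have card: "card (ends ` M) = card M" if "M \<subseteq> set es" for M
    using inj_on_subset[OF inj that] by (rule card_image)
  have "finite E" using E by auto
  then have fin: "finite {M. temporal_matching E lam M}"
    by (rule finite_subset[rotated, OF finite_Pow_iff[THEN iffD2]]) (auto simp: temporal_matching_def)
  show ?thesis
    unfolding max_temporal_matching_def
  proof (rule Max_eqI)
    show "finite (card ` {M. temporal_matching E lam M})" using fin by simp
  next
    fix k assume "k \<in> card ` {M. temporal_matching E lam M}"
    then obtain M' where M': "temporal_matching E lam M'" "k = card M'" by blast
    then have "M' \<subseteq> ends ` set es" by (simp add: E temporal_matching_def)
    then obtain M where M: "M \<subseteq> set es" "M' = ends ` M" by (meson subset_image_iff)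
    then have "packing slots M" using M'(1) match by simp
    then have "card M \<le> table_val f X {}" by (intro solves_le[OF sol M(1)]) auto
    then show "k \<le> table_val f X {}" using M M'(2) card by simp
  next
    obtain M where M: "M \<subseteq> set es" "packing slots M" "card M = table_val f X {}"
      by (rule solves_exists[OF sol])
    then have "temporal_matching E lam (ends ` M)" "card (ends ` M) = table_val f X {}"
      using match card by simp_all
    then show "table_val f X {} \<in> card ` {M. temporal_matching E lam M}"
      by (metis image_eqI mem_Collect_eq)
  qed
qed

section \<open>Assembly of correctness and running time\<close>

theorem theorem18:
  "\<exists>(P :: program) (p :: nat poly).
     \<forall>(V :: nat set) E lam tau D x.
       temporal_graph V E lam tau \<longrightarrow>
       rooted_tree_decomposition V E D \<longrightarrow>
       encodes V E lam tau D x \<longrightarrow>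
       (\<exists>t. runs P x (enc_nat (max_temporal_matching E lam)) t \<and>
            t \<le> 2 ^ ((rtree_width D)\<^sup>2) * 8 ^ (rtree_width D * tau) * poly p (size x))"
\<comment> \<open>The degree 6 is the fifth power of the cost per node times the number of nodes.
  The constant 4000 rounds up 3690: 3200 for the traversal and the rest for labels, variables,
  output and local work.\<close>
proof (rule exI[of _ prog], rule exI[of _ "[:4000:] * [:1, 1:] ^ 6"], intro allI impI)
  fix V :: "nat set" and E lam tau D x
  assume graph: "temporal_graph V E lam tau" and dec: "rooted_tree_decomposition V E D"
    and enc: "encodes V E lam tau D x"
  obtain vs es d where vs: "distinct vs" "set vs = V"
    and es: "distinct (map ends es)" "ends ` set es = E"
      "\<forall>e\<in>set es. distinct (snd e) \<and> set (snd e) = lam (ends e)"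
    and d: "\<forall>b\<in>set_rtree d. distinct b" "map_rtree set d = D"
    and x: "x = enc_list [enc_nats vs, enc_list (map enc_tedge es), enc_nat tau, enc_rtree d]"
    using enc unfolding encodes_def by blast
  define w where "w = rtree_width D"
  define ts where "ts = occurring_labels es []"
  define X where "X = List.product vs ts"
  define f where "f = absorb X es [] Zero [d]"
  define N where "N = size x"
  define Q where "Q = (8::nat) ^ (w * tau)"
  \<comment> \<open>The unary values are bounded crudely by nodes times edges, since an edge may be
    added at every node.\<close>
  let ?H = "N\<^sup>2"
  have pos: "positions D = positions d" and lab: "p \<in> positions d \<Longrightarrow> label_at D p = set (label_at d p)" for p
    unfolding d(2)[symmetric] by (simp_all add: positions_map_rtree label_at_map_rtree)
  have td: "(\<Union>p\<in>positions D. label_at D p) = V" "\<forall>e\<in>E. \<exists>p\<in>positions D. e \<subseteq> label_at D p"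
    "\<forall>v\<in>V. connected_on {p \<in> positions D. v \<in> label_at D p} (position_edges D)"
    using dec unfolding rooted_tree_decomposition_def tree_decomposition_def by blast+

  have ts: "distinct ts" "set ts = (\<Union>e\<in>set es. set (snd e))"
    by (simp_all add: ts_def occurring_labels_distinct occurring_labels_set)
  have X: "distinct X" using vs ts by (simp add: X_def distinct_product)
  have slots: "\<forall>e\<in>set es. slots e \<subseteq> set X \<and> snd e \<noteq> []"
  proof (intro ballI conjI)
    fix e assume e: "e \<in> set es"
    then have "ends e \<in> E" using es(2) by blast
    then have "ends e \<subseteq> V" "lam (ends e) \<noteq> {}"
      using graph by (auto simp: temporal_graph_def simple_graph_def)
    then show "slots e \<subseteq> set X" "snd e \<noteq> []"
      using e es(3) vs(2) ts(2) by (auto simp: slots_def X_def)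
  qed
  have conn: "connected_on {p \<in> positions d. v \<in> set (label_at d p)} (position_edges d)" for v
  proof -
    have eq: "{p \<in> positions d. v \<in> set (label_at d p)} = {p \<in> positions D. v \<in> label_at D p}"
      using pos lab by auto
    have "position_edges d = position_edges D" by (simp add: position_edges_def pos)
    moreover have "connected_on {p \<in> positions D. v \<in> label_at D p} (position_edges D)"
    proof (cases "v \<in> V")
      case True
      then show ?thesis using td(3) by blast
    next
      case False
      then have none: "{p \<in> positions D. v \<in> label_at D p} = {}" using td(1) by auto
      show ?thesis unfolding none connected_on_def by blast
    qed
    ultimately show ?thesis by (simp add: eq)
  qed
  have coh: "coherent d" by (rule coherent_subtree[OF conn, of "[]"]) simp
  have all: "tree_edges es d = set es"
  proof -
    have "\<exists>l\<in>set_rtree d. ends e \<subseteq> set l" if "e \<in> set es" for e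
    proof -
      have "ends e \<in> E" using es(2) that by blast
      then obtain p where "p \<in> positions D" "ends e \<subseteq> label_at D p" using td(2) by blast
      then have "p \<in> positions d" "ends e \<subseteq> set (label_at d p)" by (simp_all add: pos lab)
      then show ?thesis by (auto simp: set_rtree_label_at)
    qed
    then show ?thesis by (auto simp: tree_edges_def)
  qed
  \<comment> \<open>No edge fits into the empty bag above the root, so the traversal may start from
    the empty set of edges and the table \<open>Zero\<close>.\<close>
  have ends_ne: "ends e \<noteq> {}" for e by (cases e rule: ends.cases) simp
  have bv: "bag_vars [] = {}" by (simp add: bag_vars_def)
  have "solves slots (bag_vars []) ({} \<union> \<Union>(tree_edges es ` set [d])) f X"
    unfolding f_def
    by (rule solves_absorb[OF X slots, where n = 0 and W = "{}"])
      (use ends_ne coh in \<open>auto simp: solves_Zero attached_def\<close>)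
  then have "solves slots {} (set es) f X" by (simp add: all bv)
  then have opt: "max_temporal_matching E lam = table_val f X {}"
    using max_temporal_matching_eq[OF es(1,2)] es(3) by simp

  have finP: "finite ((\<lambda>p. card (label_at D p)) ` positions D)" by (intro finite_imageI finite_positions)
  have card_label: "card (label_at D p) \<le> w + 1" if "p \<in> positions D" for p
    using Max_ge[OF finP imageI[OF that]] by (simp add: w_def rtree_width_def width_def)
  have bag: "length b \<le> w + 1" "distinct b" if "b \<in> insert [] (set_rtree d)" for b
  proof -
    show b: "distinct b" using that d(1) by auto
    show "length b \<le> w + 1"
      using that card_label pos lab b by (auto simp: set_rtree_label_at simp flip: distinct_card)
  qed
  have w1: "1 \<le> w" if "0 < length ts"
  proof -
    have "E \<noteq> {}" using that es(2) ts(2) by auto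
    then obtain e where e: "e \<in> E" by blast
    then obtain p where p: "p \<in> positions D" "e \<subseteq> label_at D p" using td(2) by blast
    have "card e = 2" "finite (label_at D p)"
      using graph e pos lab p by (auto simp: temporal_graph_def simple_graph_def)
    then have "2 \<le> card (label_at D p)" using card_mono[OF _ p(2)] by simp
    then show ?thesis using card_label[OF p(1)] by simp
  qed
  have "set ts \<subseteq> {1..tau}"
    using graph es ts(2) by (auto simp: temporal_graph_def)
  then have "card (set ts) \<le> card {1..tau}" by (intro card_mono) auto
  then have tau: "length ts \<le> tau" using ts(1) by (simp add: distinct_card)

  let ?E = "enc_list (map enc_tedge es)"
  have sizes: "size (enc_nats vs) + size ?E + size (enc_rtree d) + 2 \<le> N"
    by (simp add: N_def x)
  have len_vs: "length vs \<le> N"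
    using length_le_size_enc_list[of "map enc_nat vs"] sizes by (simp add: enc_nats_def)
  have len_es: "length es \<le> N"
    using length_le_size_enc_list[of "map enc_tedge es"] sizes by simp
  have len_ts: "length ts \<le> N"
    using length_occurring_labels[of es "[]"] sizes by (simp add: ts_def)
  have len_X: "length X \<le> N\<^sup>2"
    using mult_le_mono[OF len_vs len_ts] by (simp add: X_def power2_eq_square)
  have nodes: "nodes d \<le> N" using nodes_le_size[of d] sizes by simp
  have size_es: "\<forall>e\<in>set es. size (enc_tedge e) \<le> N"
    using size_enc_list_ge[of _ "map enc_tedge es"] sizes by fastforce
  have size_bag: "size (enc_nats b) \<le> N" if "b \<in> insert [] (set_rtree d)" for b
    using that size_label_le[of b d] sizes by (auto simp: enc_nats_def)
  have cnt_le: "cnt (B \<times> UNIV) X = length (filter (\<lambda>v. v \<in> B) vs) * length ts"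
    "length (filter (\<lambda>v. v \<in> B) vs) \<le> card B" if "finite B" for B
    using cnt_product length_filter_le_card[OF vs(1) that] by (auto simp: X_def)
  have Q1: "1 \<le> Q" by (simp add: Q_def)
  have pow_bag: "2 ^ cnt (bag_vars b) X \<le> Q" if "b \<in> insert [] (set_rtree d)" for b
  proof -
    have "length (filter (\<lambda>v. v \<in> set b) vs) \<le> w + 1"
      using cnt_le(2)[of "set b"] bag[OF that] by (simp add: distinct_card)
    then show ?thesis
      using pow_bound2[OF tau w1] by (simp add: bag_vars_def cnt_le Q_def)
  qed
  have wt_bag: "wt (bag_vars b) (bag_vars b \<inter> bag_vars l) X \<le> Q"
    if "b \<in> insert [] (set_rtree d)" "l \<in> insert [] (set_rtree d)" "\<not> set l \<subseteq> set b" for b l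
  proof -
    let ?a = "length (filter (\<lambda>v. v \<in> set b \<inter> set l) vs)"
    let ?c = "length (filter (\<lambda>v. v \<in> set b - set l) vs)"
    \<comment> \<open>The child bag \<open>l\<close> has at most \<open>w + 1\<close> vertices and
      one of them is outside \<open>b\<close>; this gives the exponent \<open>w\<close> for base
      3.\<close>
    have "set b \<inter> set l \<subset> set l" using that(3) by blast
    then have "card (set b \<inter> set l) < card (set l)" by (intro psubset_card_mono) auto
    then have a: "?a \<le> w"
      using cnt_le(2)[of "set b \<inter> set l"] bag[OF that(2)] by (simp add: distinct_card)
    have "card (set b \<inter> set l) + card (set b - set l) = card (set b)"
      by (subst card_Un_disjoint[symmetric]) (auto intro: arg_cong[where f = card])
    then have c: "?a + ?c \<le> w + 1"
      using cnt_le(2)[of "set b \<inter> set l"] cnt_le(2)[of "set b - set l"] bag[OF that(1)]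
      by (simp add: distinct_card)
    have "bag_vars b \<inter> (bag_vars b \<inter> bag_vars l) = (set b \<inter> set l) \<times> UNIV"
      "sym_diff (bag_vars b) (bag_vars b \<inter> bag_vars l) = (set b - set l) \<times> UNIV"
      by (auto simp: bag_vars_def)
    note sets = this
    have "wt (bag_vars b) (bag_vars b \<inter> bag_vars l) X = 3 ^ (?a * length ts) * 2 ^ (?c * length ts)"
      unfolding wt_def sets by (simp only: cnt_le finite_Int finite_Diff finite_set simp_thms)
    then show ?thesis using pow_bound[OF tau w1 a c] by (simp add: Q_def)
  qed

  have enc0: "enc_nats [] = Atom" by (simp add: enc_nats_def)
  have lab_c: "computes prog LABELS [?E, Atom] (enc_nats ts) (200 * (N + 1) ^ 3)"
  proof -
    have "(length es + 1) * ((size ?E + 2) * (100 * (size ?E + size (enc_nats [])) + 100)) \<le>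
        (N + 1) * ((2 * (N + 1)) * (100 * (N + 1)))"
      using len_es sizes by (intro mult_le_mono) (auto simp: enc0)
    also have "\<dots> = 200 * (N + 1) ^ 3" by (simp only: power3_eq_cube)
    finally show ?thesis
      using computes_mono[OF labels_computes[of es "[]"]] by (simp add: ts_def enc0)
  qed
  have prod_c: "computes prog PRODUCT [enc_nats vs, enc_nats ts] (enc_vars X) (100 * (N + 1) ^ 2)"
  proof -
    have "(length vs + 1) * (60 * length ts + 100) \<le> (N + 1) * (100 * (N + 1))"
      using len_vs len_ts by (intro mult_le_mono) auto
    also have "\<dots> = 100 * (N + 1)\<^sup>2" by (simp add: power2_eq_square algebra_simps)
    finally show ?thesis using computes_mono[OF product_computes] by (simp add: X_def)
  qed
  have chain: "nodes d * length es \<le> ?H"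
    using mult_le_mono[OF nodes len_es] by (simp add: power2_eq_square)
  have abs_c: "computes prog ABSORB [Atom, Atom, Cell (enc_rtree d) Atom, enc_vars X, ?E] (enc_table f)
      (3200 * (N + 1) ^ 6 * Q + 20)"
  proof -
    have c: "computes prog ABSORB
        [enc_nats [], enc_table Zero, enc_list (map enc_rtree [d]), enc_vars X, ?E]
        (enc_table (absorb X es [] Zero [d]))
        (sum_list (map nodes [d]) * node_bound N ?H (length X) Q + 20)"
      by (rule absorb_computes[where BB = "insert [] (set_rtree d)" and n = 0,
            OF size_bag pow_bag wt_bag size_es len_es]) (use chain in auto)
    have "nodes d * node_bound N ?H (length X) Q \<le> (N + 1) * (3200 * (N + 1) ^ 5 * Q)"
      using nodes by (intro mult_le_mono node_bound_le len_X Q1) auto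
    also have "(N + 1) * (3200 * (N + 1) ^ 5 * Q) = 3200 * (N + 1) ^ 6 * Q"
      using power_Suc[of "N + 1" 5] by (simp add: algebra_simps)
    finally have "sum_list (map nodes [d]) * node_bound N ?H (length X) Q + 20 \<le>
        3200 * (N + 1) ^ 6 * Q + 20"
      by simp
    from computes_mono[OF c this] show ?thesis by (simp only: f_def enc0 enc_table.simps list.map enc_list_simps)
  qed
  have "fits (bag_vars []) f X (0 + sum_list (map nodes [d]) * length es)"
    unfolding f_def by (rule absorb_fits) simp
  then have "fits {} f X ?H" by (rule fits_mono) (use chain bv in auto)
  note bin = bin_computes[OF this]
  have bin_c: "computes prog BIN [enc_table f] (enc_nat (table_val f X {})) (120 * (N + 1) ^ 4)"
  proof (rule computes_mono[OF bin])
    have "(?H + length X + 1) * (20 * ?H + 60) \<le> (2 * (N + 1)\<^sup>2) * (60 * (N + 1)\<^sup>2)"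
      using len_X by (intro mult_le_mono) (auto simp: power2_eq_square)
    also have "\<dots> = 120 * (N + 1) ^ 4" by (simp flip: power_add)
    finally show "(?H + length X + 1) * (20 * ?H + 60) \<le> 120 * (N + 1) ^ 4" .
  qed
  have main: "computes prog 0 [x] (enc_nat (table_val f X {}))
      (200 * (N + 1) ^ 3 + 100 * (N + 1)\<^sup>2 + (3200 * (N + 1) ^ 6 * Q + 20) + 120 * (N + 1) ^ 4 + 50)"
    using computesD[OF lab_c] computesD[OF prod_c] computesD[OF abs_c] computesD[OF bin_c]
    by (intro computesI) (simp_all add: main_body_def x)
  let ?t = "fun_time prog 0 [x]"
  have "eval prog [x] (prog ! 0) (enc_nat (table_val f X {})) ?t"
    using computesD(1,2)[OF main] fun_ok_eval by (auto simp: fun_ok_def)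
  then have "runs prog x (enc_nat (max_temporal_matching E lam)) ?t"
    by (simp add: runs_def opt) (simp add: prog_def)
  moreover have "?t \<le> 2 ^ (rtree_width D)\<^sup>2 * 8 ^ (rtree_width D * tau) *
      poly ([:4000:] * [:1, 1:] ^ 6) (size x)"
  proof -
    define R where "R = (N + 1) ^ 6 * Q"
    have p: "(N + 1) ^ i \<le> R" if "i \<le> 6" for i
      using mult_le_mono[of "(N + 1) ^ i" "(N + 1) ^ 6" 1 Q] Q1 that power_increasing[of i 6 "N + 1"]
      by (simp add: R_def)
    have "?t \<le> 4000 * R"
      using computesD(3)[OF main] p[of 3] p[of 2] p[of 4] p[of 0, unfolded power_0]
      unfolding mult.assoc R_def[symmetric] by simp
    \<comment> \<open>The exponential cost of the tables is contained in \<open>R\<close>; the new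
      factor is at least 1.\<close>
    also have "\<dots> \<le> 2 ^ w\<^sup>2 * (4000 * R)" by simp
    also have "\<dots> = 2 ^ w\<^sup>2 * Q * (4000 * (1 + N) ^ 6)" by (simp add: R_def algebra_simps)
    finally show ?thesis by (simp add: w_def Q_def N_def poly_power)
  qed
  ultimately show "\<exists>t. runs prog x (enc_nat (max_temporal_matching E lam)) t \<and>
      t \<le> 2 ^ (rtree_width D)\<^sup>2 * 8 ^ (rtree_width D * tau) *
        poly ([:4000:] * [:1, 1:] ^ 6) (size x)" by blast
qed

end
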